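(* There exists an absolute constant $c>0$ such that for every integer $N>1$ one can find a permutation $\sigma\in\Sigma_N$ with $$\|T_{\sigma,N}\|_{L^2\to L^{2,\infty}}\ge c\sqrt{\log N}.$$
   Context: $\mathbb{T}=\mathbb{R}/\mathbb{Z}$ with Lebesgue measure $|\cdot|$. $\Sigma_N$ is the set of all permutations of $\{1,2,\ldots,N\}$. For an integer $N\ge 1$ and $\sigma\in\Sigma_N$ the operator $T_{\sigma,N}$ on $L^2(\mathbb{T})$ is $$T_{\sigma,N}f(x)=\max_{1\le m\le N}\left|\sum_{k=1}^m c_{\sigma(k)}e^{2\pi i\sigma(k)x}\right|,\qquad c_k=\int_{\mathbb{T}}f(x)e^{-2\pi ikx}\,dx.$$ The weak $L^2$-norm of an operator $T$ on $L^2(\mathbb{T})$ is $$\|T\|_{L^2\to L^{2,\infty}}=\sup_{\|f\|_2\le 1,\ \lambda>0}\lambda\,\big(|\{x:|Tf(x)|>\lambda\}|\big)^{1/2}.$$ *)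

theory Defs
  imports "HOL-Analysis.Analysis"
begin

text \<open>
  The torus \<open>\<real>/\<int>\<close> is represented by its fundamental domain \<open>[0,1)\<close>; a function on the
  torus is a function on \<open>\<real>\<close> of which only the values on \<open>[0,1)\<close> matter.
\<close>

abbreviation torus :: "real measure" where
  "torus \<equiv> lebesgue_on {0..<1}"

text \<open>
  Elements of \<open>L\<^sup>2\<close> are represented by measurable functions rather than by classes modulo
  equality almost everywhere.
\<close>

definition L2_torus :: "(real \<Rightarrow> complex) set" where
  "L2_torus = {f \<in> borel_measurable torus. integrable torus (\<lambda>x. (norm (f x))\<^sup>2)}"

definition L2_norm :: "(real \<Rightarrow> complex) \<Rightarrow> real" where
  "L2_norm f = sqrt (LINT x|torus. (norm (f x))\<^sup>2)"

definition fourier_coeff :: "(real \<Rightarrow> complex) \<Rightarrow> int \<Rightarrow> complex" where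
  "fourier_coeff f k =
     (LINT x|torus. f x * exp (- 2 * of_real pi * \<i> * of_int k * of_real x))"

definition max_partial_sum ::
    "(nat \<Rightarrow> nat) \<Rightarrow> nat \<Rightarrow> (real \<Rightarrow> complex) \<Rightarrow> real \<Rightarrow> real" where
  "max_partial_sum \<sigma> N f x =
     Max ((\<lambda>m. norm (\<Sum>k=1..m. fourier_coeff f (int (\<sigma> k)) *
                  exp (2 * of_real pi * \<i> * of_nat (\<sigma> k) * of_real x))) ` {1..N})"

text \<open>
  The supremum is taken in \<^typ>\<open>ennreal\<close>, so that an operator that is not of weak type
  has norm \<open>\<infinity>\<close>.
\<close>

definition weak_L2_norm :: "((real \<Rightarrow> complex) \<Rightarrow> real \<Rightarrow> real) \<Rightarrow> ennreal" where
  "weak_L2_norm T =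
     (SUP (f, l) \<in> {f \<in> L2_torus. L2_norm f \<le> 1} \<times> {0<..}.
        ennreal (l * sqrt (measure torus {x \<in> space torus. \<bar>T f x\<bar> > l})))"

end

theory Submission
  imports Defs "HOL-Library.Sublist"
begin

text \<open>
  In a complete binary tree of depth \<open>n\<close> let every node \<open>w\<close> carry a \<open>\<plusminus>1\<close>-valued function, restricted to
  the set where the signs at the ancestors of \<open>w\<close> point towards \<open>w\<close>. The sum of all these
  functions has squared norm \<open>n\<close>. If the nodes are added in in-order, then at a point that descends
  to the leaf \<open>v\<close> the partial sum up to \<open>v\<close> contains exactly the right turns on the way to \<open>v\<close>, about
  \<open>n/2\<close> of them, so the maximal partial sum exceeds the norm by a factor of order \<open>\<surd>n\<close>.

  To realise this with blocks of characters whose total number is exponential in \<open>n\<close>, the sign at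
  the node \<open>w\<close> is a square wave in \<open>m\<^sub>w x\<close> with random integers \<open>m\<^sub>w\<close> modulo \<open>Q\<close>. The Fourier
  coefficients \<open>O(1/k)\<close> of the square wave are summable to the power \<open>3/2\<close> with a sum that is
  multiplicative over the levels, so keeping only the coefficients above \<open>\<delta>\<^sup>n\<close> leaves exponentially
  many terms and an exponentially small error. For \<open>Q\<close> exponentially large the remaining
  frequencies are distinct with high probability. A common random shift \<open>m0\<close> of all frequencies
  passes from the grid \<open>a/Q\<close> to the points next to it. This bounds the maximal function
  from below in \<open>L\<^sup>1\<close>, which is dominated by weak \<open>L\<^sup>2\<close>.
\<close>


section \<open>Characters of cyclic groups\<close>

definition chr :: "nat \<Rightarrow> int \<Rightarrow> complex" where
  "chr Q j = cis (2 * pi * of_int j / of_nat Q)"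

lemma chr_0 [simp]: "chr Q 0 = 1"
  by (simp add: chr_def)

lemma norm_chr [simp]: "norm (chr Q j) = 1"
  by (simp add: chr_def)

lemma chr_add: "chr Q (i + j) = chr Q i * chr Q j"
  by (simp add: chr_def cis_mult add_divide_distrib distrib_left)

lemma cnj_chr: "cnj (chr Q j) = chr Q (- j)"
  by (simp add: chr_def cis_cnj)

lemma chr_uminus_mult [simp]: "chr Q (- j) * chr Q j = 1"
  by (simp flip: chr_add)

lemma chr_sum: "chr Q (sum f A) = (\<Prod>a\<in>A. chr Q (f a))"
  by (induction A rule: infinite_finite_induct) (auto simp: chr_add)

lemma chr_eq_1_iff:
  assumes "Q > 0"
  shows "chr Q j = 1 \<longleftrightarrow> int Q dvd j"
proof
  assume "int Q dvd j"
  then obtain k where "j = int Q * k" by auto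
  then show "chr Q j = 1"
    using assms cis_multiple_2pi[of "of_int k"] by (simp add: chr_def mult.assoc)
next
  assume "chr Q j = 1"
  then have "cos (2 * pi * of_int j / of_nat Q) = 1"
    by (simp add: chr_def complex_eq_iff)
  then obtain n where "2 * pi * of_int j / of_nat Q = of_int n * 2 * pi"
    by (auto simp: cos_one_2pi_int)
  then have "(of_int j :: real) = of_int n * of_nat Q"
    using assms by (simp add: field_simps)
  then have "j = n * int Q"
    by (metis of_int_eq_iff of_int_mult of_int_of_nat_eq)
  then show "int Q dvd j" by simp
qed

lemma chr_mod [simp]: "chr Q (j mod int Q) = chr Q j"
proof (cases "Q = 0")
  case False
  have "chr Q (int Q * (j div int Q)) = 1"
    using False by (subst chr_eq_1_iff) auto
  moreover have "j = j mod int Q + int Q * (j div int Q)" by simp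
  ultimately show ?thesis by (metis chr_add mult.right_neutral)
qed simp

lemma chr_mult_mod [simp]: "chr Q (k * (j mod int Q)) = chr Q (k * j)"
  by (metis chr_mod mod_mult_right_eq)

lemma sum_int_nat: "(\<Sum>z\<in>{0..<int Q}. f z) = (\<Sum>z<Q. f (int z))"
  by (rule sum.reindex_bij_witness[where i = int and j = nat]) auto

lemma sum_chr_geometric:
  "(\<Sum>z<n. chr Q (j * int z)) * (1 - chr Q j) = 1 - chr Q (j * int n)"
proof (induction n)
  case (Suc n)
  have "chr Q (j * int (Suc n)) = chr Q j * chr Q (j * int n)"
    by (simp add: distrib_left chr_add)
  then show ?case by (simp only: sum.lessThan_Suc distrib_right Suc) (simp add: algebra_simps)
qed simp

lemma dvd_abs_less_imp_0:
  fixes j :: int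
  assumes "d dvd j" "\<bar>j\<bar> < d"
  shows "j = 0"
  using assms dvd_imp_le_int[of j d] by fastforce

lemma sum_chr:
  assumes "Q > 0"
  shows "(\<Sum>z\<in>{0..<int Q}. chr Q (j * z)) = (if int Q dvd j then of_nat Q else 0)"
proof (cases "int Q dvd j")
  case True
  then have "chr Q (j * z) = 1" for z
    using assms by (simp add: chr_eq_1_iff)
  then show ?thesis using True by simp
next
  case False
  have "chr Q (j * int Q) = 1"
    using assms by (simp add: chr_eq_1_iff)
  then have "(\<Sum>z<Q. chr Q (j * int z)) * (1 - chr Q j) = 0"
    by (simp add: sum_chr_geometric)
  moreover have "chr Q j \<noteq> 1" using False assms by (simp add: chr_eq_1_iff)
  ultimately show ?thesis using False by (simp add: sum_int_nat)
qed

text \<open>Centred representatives of the residues mod \<open>Q\<close>. For these the size of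
  \<open>k\<close> measures the distance to the multiples of \<open>Q\<close>, so that decay in
  \<open>\<bar>k\<bar>\<close> is meaningful.\<close>

definition dual :: "nat \<Rightarrow> int set" where
  "dual Q = {- int (Q div 2)..<int Q - int (Q div 2)}"

lemma finite_dual [simp]: "finite (dual Q)"
  by (simp add: dual_def)

lemma zero_in_dual: "Q > 0 \<Longrightarrow> 0 \<in> dual Q"
  by (auto simp: dual_def)

lemma dual_abs_le_even: "even Q \<Longrightarrow> k \<in> dual Q \<Longrightarrow> 2 * \<bar>k\<bar> \<le> int Q"
  by (auto simp: dual_def elim!: evenE)

lemma dual_dvd_diff_iff:
  assumes "k \<in> dual Q" "l \<in> dual Q"
  shows "int Q dvd (k - l) \<longleftrightarrow> k = l"
proof
  assume "int Q dvd (k - l)"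
  moreover have "\<bar>k - l\<bar> < int Q" using assms by (auto simp: dual_def)
  ultimately have "k - l = 0" by (rule dvd_abs_less_imp_0)
  then show "k = l" by simp
qed simp

lemma sum_chr_dual:
  assumes "Q > 0"
  shows "(\<Sum>k\<in>dual Q. chr Q (k * j)) = (if int Q dvd j then of_nat Q else 0)"
proof -
  let ?h = "int (Q div 2)"
  have "(\<Sum>k\<in>dual Q. chr Q (k * j)) = (\<Sum>z\<in>{0..<int Q}. chr Q ((z - ?h) * j))"
    by (rule sum.reindex_bij_witness[where i = "\<lambda>z. z - ?h" and j = "\<lambda>k. k + ?h"])
       (auto simp: dual_def)
  also have "\<dots> = (\<Sum>z\<in>{0..<int Q}. chr Q (- ?h * j) * chr Q (j * z))"
    by (intro sum.cong) (simp_all add: algebra_simps flip: chr_add)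
  also have "\<dots> = chr Q (- ?h * j) * (\<Sum>z\<in>{0..<int Q}. chr Q (j * z))"
    by (simp add: sum_distrib_left)
  also have "\<dots> = (if int Q dvd j then of_nat Q else 0)"
    using assms by (auto simp: sum_chr chr_eq_1_iff)
  finally show ?thesis .
qed

subsection \<open>Fourier coefficients on a cyclic group\<close>

definition cyc_coeff :: "nat \<Rightarrow> (int \<Rightarrow> real) \<Rightarrow> int \<Rightarrow> complex" where
  "cyc_coeff Q g k = (\<Sum>z\<in>{0..<int Q}. of_real (g z) * chr Q (- k * z)) / of_nat Q"

text \<open>Interchanging the two sums leaves the character sum over \<open>dual Q\<close> at
  \<open>y - z\<close>, which vanishes unless \<open>z = y\<close>.\<close>

lemma cyc_inversion:
  assumes "Q > 0" "y \<in> {0..<int Q}"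
  shows "(\<Sum>k\<in>dual Q. cyc_coeff Q g k * chr Q (k * y)) = of_real (g y)"
proof -
  have "(\<Sum>k\<in>dual Q. cyc_coeff Q g k * chr Q (k * y))
      = (\<Sum>k\<in>dual Q. \<Sum>z\<in>{0..<int Q}. of_real (g z) / of_nat Q * chr Q (k * (y - z)))"
    unfolding cyc_coeff_def sum_divide_distrib sum_distrib_right
    by (intro sum.cong) (simp_all add: algebra_simps flip: chr_add)
  also have "\<dots> = (\<Sum>z\<in>{0..<int Q}. of_real (g z) / of_nat Q * (\<Sum>k\<in>dual Q. chr Q (k * (y - z))))"
    by (subst sum.swap) (simp add: sum_distrib_left)
  also have "\<dots> = (\<Sum>z\<in>{0..<int Q}. if z = y then of_real (g z) else 0)"
  proof (intro sum.cong refl)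
    fix z assume z: "z \<in> {0..<int Q}"
    have "int Q dvd (y - z) \<longleftrightarrow> z = y"
    proof
      assume "int Q dvd (y - z)"
      moreover have "\<bar>y - z\<bar> < int Q" using assms(2) z by auto
      ultimately have "y - z = 0" by (rule dvd_abs_less_imp_0)
      then show "z = y" by simp
    qed simp
    then show "of_real (g z) / of_nat Q * (\<Sum>k\<in>dual Q. chr Q (k * (y - z)))
             = (if z = y then of_real (g z) else 0)"
      using assms(1) by (simp add: sum_chr_dual)
  qed
  also have "\<dots> = of_real (g y)" using assms(2) by simp
  finally show ?thesis .
qed

lemma norm_cyc_coeff_le_1:
  assumes "\<And>z. \<bar>g z\<bar> \<le> 1"
  shows "norm (cyc_coeff Q g k) \<le> 1"
proof -
  have "norm (\<Sum>z\<in>{0..<int Q}. of_real (g z) * chr Q (- k * z)) \<le> (\<Sum>z\<in>{0..<int Q}. 1)"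
    by (rule order_trans[OF norm_sum sum_mono]) (simp add: norm_mult assms)
  then show ?thesis by (cases "Q = 0") (auto simp: cyc_coeff_def norm_divide)
qed

lemma cyc_coeff_1:
  assumes "Q > 0" "k \<in> dual Q"
  shows "cyc_coeff Q (\<lambda>_. 1) k = (if k = 0 then 1 else 0)"
  using assms dual_dvd_diff_iff[OF assms(2) zero_in_dual[OF assms(1)]]
    sum_chr[OF assms(1), of "- k"]
  by (simp add: cyc_coeff_def)

lemma cyc_coeff_affine:
  "cyc_coeff Q (\<lambda>z. a + b * g z) k = of_real a * cyc_coeff Q (\<lambda>_. 1) k + of_real b * cyc_coeff Q g k"
  by (simp add: cyc_coeff_def sum.distrib sum_distrib_left add_divide_distrib algebra_simps)

subsection \<open>The square wave\<close>

definition half :: "nat \<Rightarrow> int \<Rightarrow> bool" where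
  "half Q y \<longleftrightarrow> y mod int Q < int (Q div 2)"

definition sqw :: "nat \<Rightarrow> int \<Rightarrow> real" where
  "sqw Q y = (if half Q y then 1 else - 1)"

lemma half_mod [simp]: "half Q (y mod int Q) = half Q y"
  by (simp add: half_def)

text \<open>Up to \<open>1 / 3\<close> the cosine is at least \<open>1 / 2\<close>, so the mean
  value theorem gives slope at least \<open>pi / 2\<close>, which exceeds 1. Beyond that the sine is
  at least \<open>1 / 2\<close> by monotonicity.\<close>

lemma sin_pi_ge:
  assumes "0 \<le> s" "s \<le> 1 / 2"
  shows "s \<le> sin (pi * s)"
proof (cases "s \<le> 1 / 3")
  case True
  show ?thesis
  proof (cases "s = 0")
    case False
    then have s: "0 < pi * s" using assms by simp
    have "\<exists>z>0. z < pi * s \<and> sin (pi * s) - sin 0 = (pi * s - 0) * cos z"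
      by (rule MVT2[OF s]) (auto intro!: derivative_eq_intros)
    then obtain z where z: "0 < z" "z < pi * s" "sin (pi * s) = pi * s * cos z" by auto
    have "pi * s \<le> pi / 3" using True by simp
    then have "cos (pi / 3) \<le> cos z"
      using z by (intro cos_monotone_0_pi_le) linarith+
    then have "1 / 2 \<le> cos z" by (simp add: cos_60)
    then have "pi * s * (1 / 2) \<le> sin (pi * s)"
      unfolding z(3) using s by (intro mult_left_mono) auto
    moreover have "s * 2 \<le> s * pi" using pi_ge_two assms(1) by (intro mult_left_mono) auto
    ultimately show ?thesis by (simp add: mult.commute)
  qed simp
next
  case False
  then have "pi * (1/6) \<le> pi * s" "pi * s \<le> pi * (1/2)"
    using assms by (intro mult_left_mono; simp)+
  then have "sin (pi / 6) \<le> sin (pi * s)"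
    by (intro sin_monotone_2pi_le) auto
  then show ?thesis using assms by (simp add: sin_30)
qed

text \<open>The chord has length \<open>2 * \<bar>sin (pi * k / Q)\<bar>\<close>, and
  \<open>sin_pi_ge\<close> applies since \<open>k\<close> is at most half a period.\<close>

lemma norm_one_minus_chr_ge:
  assumes "Q > 0" "2 * \<bar>k\<bar> \<le> int Q"
  shows "2 * of_int \<bar>k\<bar> / of_nat Q \<le> norm (1 - chr Q k)"
proof -
  let ?s = "of_int \<bar>k\<bar> / of_nat Q :: real"
  have k: "(2 * of_int \<bar>k\<bar> :: real) \<le> of_nat Q" using assms(2) by linarith
  have "norm (1 - chr Q k) = norm (chr Q k - 1)" by (simp add: norm_minus_commute)
  also have "\<dots> = 2 * \<bar>sin (2 * pi * of_int k / of_nat Q / 2)\<bar>"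
    using dist_exp_i_1[of "2 * pi * of_int k / of_nat Q"]
    by (simp add: chr_def cis_conv_exp)
  also have "2 * pi * of_int k / of_nat Q / 2 = pi * (of_int k / of_nat Q :: real)" by simp
  also have "\<bar>sin (pi * (of_int k / of_nat Q))\<bar> = \<bar>sin (pi * ?s)\<bar>"
    by (cases "k \<ge> 0") auto
  finally have eq: "norm (1 - chr Q k) = 2 * \<bar>sin (pi * ?s)\<bar>" .
  have "?s \<le> sin (pi * ?s)"
    using k assms(1) by (intro sin_pi_ge) (auto simp: field_simps)
  then have "2 * ?s \<le> 2 * \<bar>sin (pi * ?s)\<bar>" by linarith
  then show ?thesis unfolding eq by simp
qed

text \<open>The second half of the period repeats the first with the opposite sign, so the
  coefficient times \<open>Q\<close> is \<open>G * (1 - c)\<close> with a geometric sum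
  \<open>G\<close> over half a period. Multiplying by \<open>1 - chr Q (- k)\<close> turns this into
  \<open>(1 - c)\<^sup>2\<close>, of modulus at most 4, while the multiplier has modulus at least
  \<open>2 * \<bar>k\<bar> / Q\<close>.\<close>

lemma cyc_coeff_sqw:
  assumes "even Q" "Q > 0" "k \<in> dual Q"
  shows "norm (cyc_coeff Q (sqw Q) k) * of_int \<bar>k\<bar> \<le> 2" "cyc_coeff Q (sqw Q) 0 = 0"
proof -
  obtain h where Q: "Q = 2 * h" using assms(1) by (elim evenE)
  define c where "c = chr Q (- k * int h)"
  define G where "G = (\<Sum>z<h. chr Q (- k * int z))"
  have split: "(\<Sum>z<2 * h. F z) = (\<Sum>z<h. F z) + (\<Sum>z<h. F (z + h))" for F :: "nat \<Rightarrow> complex"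
    using sum.nat_group[of F h 2] by (simp add: numeral_2_eq_2 mult_2 sum.shift_bounds_nat_ivl[of F 0 h h, simplified] lessThan_atLeast0 add.commute)
  have lo: "sqw Q (int z) = 1" and hi: "sqw Q (int (z + h)) = - 1" if "z < h" for z
    using that by (auto simp: sqw_def half_def Q)
  have gen: "cyc_coeff Q (sqw Q) j * of_nat Q
      = (\<Sum>z<h. chr Q (- j * int z)) - (\<Sum>z<h. chr Q (- j * int (z + h)))" for j
  proof -
    have "cyc_coeff Q (sqw Q) j * of_nat Q
        = (\<Sum>z<2 * h. of_real (sqw Q (int z)) * chr Q (- j * int z))"
      using assms(2) unfolding cyc_coeff_def sum_int_nat by (simp add: Q)
    also have "\<dots> = (\<Sum>z<h. of_real (sqw Q (int z)) * chr Q (- j * int z))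
        + (\<Sum>z<h. of_real (sqw Q (int (z + h))) * chr Q (- j * int (z + h)))"
      by (rule split)
    also have "\<dots> = (\<Sum>z<h. chr Q (- j * int z)) + (\<Sum>z<h. - chr Q (- j * int (z + h)))"
      by (intro arg_cong2[of _ _ _ _ "(+)"] sum.cong) (simp_all only: lo hi lessThan_iff, simp_all)
    finally show ?thesis by (simp add: sum_negf)
  qed
  show "cyc_coeff Q (sqw Q) 0 = 0"
    using gen[of 0] assms(2) by simp
  have "(\<Sum>z<h. chr Q (- k * int (z + h))) = c * G"
    unfolding c_def G_def sum_distrib_left
    by (intro sum.cong) (simp_all add: algebra_simps flip: chr_add)
  then have eq: "cyc_coeff Q (sqw Q) k * of_nat Q = G * (1 - c)"
    unfolding gen[of k] by (simp add: G_def algebra_simps)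
  have G: "G * (1 - chr Q (- k)) = 1 - c"
    using sum_chr_geometric[of Q "- k" h] by (simp add: G_def c_def)
  have c: "norm (1 - c) \<le> 2"
    using norm_triangle_ineq4[of 1 c] by (simp add: c_def)
  have "norm (cyc_coeff Q (sqw Q) k) * of_nat Q * norm (1 - chr Q (- k))
      = norm (cyc_coeff Q (sqw Q) k * of_nat Q * (1 - chr Q (- k)))"
    by (simp add: norm_mult)
  also have "\<dots> = norm ((1 - c) * (G * (1 - chr Q (- k))))"
    unfolding eq by (simp add: mult_ac)
  also have "\<dots> = norm (1 - c) * norm (1 - c)"
    unfolding G by (rule norm_mult)
  also have "\<dots> \<le> 2 * 2" using c by (intro mult_mono) auto
  finally have 4: "norm (cyc_coeff Q (sqw Q) k) * of_nat Q * norm (1 - chr Q (- k)) \<le> 4" by simp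
  have "2 * of_int \<bar>- k\<bar> / of_nat Q \<le> norm (1 - chr Q (- k))"
    using dual_abs_le_even[OF assms(1,3)] assms(2) by (intro norm_one_minus_chr_ge) auto
  then have "norm (cyc_coeff Q (sqw Q) k) * of_nat Q * (2 * of_int \<bar>- k\<bar> / of_nat Q) \<le> 4"
    by (intro order_trans[OF mult_left_mono 4]) auto
  then show "norm (cyc_coeff Q (sqw Q) k) * of_int \<bar>k\<bar> \<le> 2"
    using assms(2) by (simp add: mult.commute)
qed


section \<open>Orthogonality and Parseval on finite powers of a cyclic group\<close>

lemma sum_chr_PiE:
  assumes "finite A" "Q > 0"
  shows "(\<Sum>y\<in>PiE A (\<lambda>_. {0..<int Q}). chr Q (\<Sum>u\<in>A. k u * y u))
       = (if \<forall>u\<in>A. int Q dvd k u then of_nat (Q ^ card A) else 0)"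
proof -
  have "(\<Sum>y\<in>PiE A (\<lambda>_. {0..<int Q}). chr Q (\<Sum>u\<in>A. k u * y u))
      = (\<Prod>u\<in>A. \<Sum>z\<in>{0..<int Q}. chr Q (k u * z))"
    unfolding chr_sum using assms(1) by (intro prod_sum_PiE[symmetric]) auto
  also have "\<dots> = (\<Prod>u\<in>A. if int Q dvd k u then of_nat Q else 0)"
    using assms(2) by (simp add: sum_chr)
  also have "\<dots> = (if \<forall>u\<in>A. int Q dvd k u then of_nat (Q ^ card A) else 0)"
    using assms by (auto intro: prod_zero)
  finally show ?thesis .
qed

text \<open>After expanding the square only the diagonal survives, because distinct elements of
  \<open>dual Q\<close> are incongruent mod \<open>Q\<close>. The set \<open>S\<close> is left free
  so as to cover both the full spectrum and the part discarded by truncation.\<close>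

lemma parseval_PiE:
  assumes "finite A" "Q > 0" and S: "S \<subseteq> PiE A (\<lambda>_. dual Q)"
  shows "(\<Sum>y\<in>PiE A (\<lambda>_. {0..<int Q}). (norm (\<Sum>k\<in>S. \<beta> k * chr Q (\<Sum>u\<in>A. k u * y u)))\<^sup>2)
       = of_nat (Q ^ card A) * (\<Sum>k\<in>S. (norm (\<beta> k))\<^sup>2)"
proof -
  let ?Y = "PiE A (\<lambda>_. {0..<int Q})"
  have "finite S" by (rule finite_subset[OF S]) (intro finite_PiE; simp add: assms)
  have eq: "(\<forall>u\<in>A. int Q dvd (k u - l u)) \<longleftrightarrow> l = k" if "k \<in> S" "l \<in> S" for k l
  proof
    assume "\<forall>u\<in>A. int Q dvd (k u - l u)"
    then have "\<forall>u\<in>A. k u = l u"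
      using that S by (metis PiE_mem dual_dvd_diff_iff subsetD)
    then show "l = k"
      using that S by (intro PiE_ext[of _ A "\<lambda>_. dual Q"]) auto
  qed simp
  have dif: "chr Q (\<Sum>u\<in>A. (k u - l u) * y u)
      = chr Q (\<Sum>u\<in>A. k u * y u) * chr Q (- (\<Sum>u\<in>A. l u * y u))" for k l y
    by (simp add: left_diff_distrib sum_subtractf flip: chr_add)
  have "of_real (\<Sum>y\<in>?Y. (norm (\<Sum>k\<in>S. \<beta> k * chr Q (\<Sum>u\<in>A. k u * y u)))\<^sup>2)
      = (\<Sum>y\<in>?Y. \<Sum>k\<in>S. \<Sum>l\<in>S. (\<beta> k * cnj (\<beta> l)) * chr Q (\<Sum>u\<in>A. (k u - l u) * y u))"
    unfolding of_real_sum complex_norm_square cnj_sum sum_product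
    by (intro sum.cong refl, simp only: dif complex_cnj_mult cnj_chr) (simp only: mult_ac)
  also have "\<dots> = (\<Sum>k\<in>S. \<Sum>y\<in>?Y. \<Sum>l\<in>S. (\<beta> k * cnj (\<beta> l)) * chr Q (\<Sum>u\<in>A. (k u - l u) * y u))"
    by (rule sum.swap)
  also have "\<dots> = (\<Sum>k\<in>S. \<Sum>l\<in>S. \<Sum>y\<in>?Y. (\<beta> k * cnj (\<beta> l)) * chr Q (\<Sum>u\<in>A. (k u - l u) * y u))"
    by (intro sum.cong refl sum.swap)
  also have "\<dots> = (\<Sum>k\<in>S. \<Sum>l\<in>S. (\<beta> k * cnj (\<beta> l)) * (\<Sum>y\<in>?Y. chr Q (\<Sum>u\<in>A. (k u - l u) * y u)))"
    by (simp only: sum_distrib_left)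
  also have "\<dots> = (\<Sum>k\<in>S. \<Sum>l\<in>S. if l = k then (\<beta> k * cnj (\<beta> k)) * of_nat (Q ^ card A) else 0)"
    by (intro sum.cong refl) (simp add: sum_chr_PiE[OF assms(1,2)] eq)
  also have "\<dots> = (\<Sum>k\<in>S. (\<beta> k * cnj (\<beta> k)) * of_nat (Q ^ card A))"
    using \<open>finite S\<close> by simp
  also have "\<dots> = of_real (of_nat (Q ^ card A) * (\<Sum>k\<in>S. (norm (\<beta> k))\<^sup>2))"
    by (simp add: complex_norm_square[symmetric] sum_distrib_left mult.commute)
  finally show ?thesis by (simp only: of_real_eq_iff)
qed

lemma sum_norm_le_sqrt_card:
  fixes F :: "'a \<Rightarrow> complex"
  shows "(\<Sum>y\<in>Y. norm (F y)) \<le> sqrt (of_nat (card Y) * (\<Sum>y\<in>Y. (norm (F y))\<^sup>2))"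
proof -
  have "(\<Sum>y\<in>Y. 1 * norm (F y))\<^sup>2 \<le> (\<Sum>y\<in>Y. 1\<^sup>2) * (\<Sum>y\<in>Y. (norm (F y))\<^sup>2)"
    by (rule Cauchy_Schwarz_ineq_sum)
  then show ?thesis by (intro real_le_rsqrt) simp
qed

section \<open>Summability of Fourier coefficients to the power 3/2\<close>

definition pow32 :: "real \<Rightarrow> real" where
  "pow32 x = x * sqrt x"

lemma pow32_mult: "pow32 (x * y) = pow32 x * pow32 y"
  by (simp add: pow32_def real_sqrt_mult)

lemma pow32_0 [simp]: "pow32 0 = 0" and pow32_1 [simp]: "pow32 1 = 1"
  by (simp_all add: pow32_def)

lemma pow32_prod: "pow32 (prod f A) = (\<Prod>a\<in>A. pow32 (f a))"
  by (induction A rule: infinite_finite_induct) (auto simp: pow32_mult)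

lemma pow32_nonneg: "x \<ge> 0 \<Longrightarrow> pow32 x \<ge> 0"
  by (simp add: pow32_def)

lemma pow32_mono: "0 \<le> x \<Longrightarrow> x \<le> y \<Longrightarrow> pow32 x \<le> pow32 y"
  unfolding pow32_def by (intro mult_mono) auto

text \<open>The frequency 0 is charged 1, and the frequencies \<open>k\<close> and
  \<open>- k\<close> are charged \<open>(2 / \<bar>k\<bar>)\<close> to the power 3/2 each. The value
  does not depend on \<open>Q\<close>.\<close>

definition pow32_bound :: real where
  "pow32_bound = 1 + 2 * (\<Sum>i. pow32 (2 / of_nat (Suc i)))"

lemma summable_pow32: "summable (\<lambda>i. pow32 (2 / of_nat (Suc i)))"
proof -
  have "pow32 (2 / of_nat i) = pow32 2 * (of_nat i powr (- 3 / 2))" if "i > 0" for i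
  proof -
    have "- 3 / 2 = (- 1 :: real) + - 1 / 2" by simp
    then have "real i powr (- 3 / 2) = real i powr (- 1) * real i powr (- 1 / 2)"
      by (simp only: powr_add)
    also have "real i powr (- 1 / 2) = 1 / sqrt (real i)"
      using that by (simp add: powr_minus_divide powr_half_sqrt)
    finally show ?thesis using that
      by (simp add: pow32_def real_sqrt_divide powr_minus_divide)
  qed
  moreover have "summable (\<lambda>i. pow32 2 * (of_nat (Suc i) powr (- 3 / 2)))"
    using summable_real_powr_iff[of "- 3 / 2"]
    by (intro summable_mult summable_Suc_iff[where f = "\<lambda>i. real i powr (- 3 / 2)", THEN iffD2]) simp
  ultimately show ?thesis by (simp del: of_nat_Suc)
qed

lemma pow32_bound_ge_1: "pow32_bound \<ge> 1"
  unfolding pow32_bound_def using suminf_nonneg[OF summable_pow32] by (simp add: pow32_nonneg)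

text \<open>The frequency 0 is bounded by \<open>c1\<close>. On the positive and on the negative
  frequencies separately \<open>k \<mapsto> \<bar>k\<bar> - 1\<close> is injective, so each half is
  dominated by the series.\<close>

lemma sum_pow32_le:
  assumes c1: "\<And>k. norm (c k) \<le> 1"
    and c2: "\<And>k. k \<in> K \<Longrightarrow> norm (c k :: complex) * of_int \<bar>k\<bar> \<le> 2"
    and "finite K"
  shows "(\<Sum>k\<in>K. pow32 (norm (c k))) \<le> pow32_bound"
proof -
  let ?s = "\<lambda>i. pow32 (2 / of_nat (Suc i))"
  have tail: "(\<Sum>k\<in>J. pow32 (norm (c k))) \<le> suminf ?s"
    if J: "J \<subseteq> K" "0 \<notin> J" "inj_on (\<lambda>k. nat \<bar>k\<bar> - 1) J" for J
  proof -
    have "(\<Sum>k\<in>J. pow32 (norm (c k))) \<le> (\<Sum>k\<in>J. ?s (nat \<bar>k\<bar> - 1))"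
    proof (intro sum_mono pow32_mono)
      fix k assume k: "k \<in> J"
      then have "k \<noteq> 0" "k \<in> K" using J by auto
      then have "norm (c k) \<le> 2 / of_int \<bar>k\<bar>"
        using c2 by (simp add: field_simps)
      also have "of_int \<bar>k\<bar> = real (Suc (nat \<bar>k\<bar> - 1))" using \<open>k \<noteq> 0\<close> by simp
      finally show "norm (c k) \<le> 2 / real (Suc (nat \<bar>k\<bar> - 1))" .
    qed simp
    also have "\<dots> = sum ?s ((\<lambda>k. nat \<bar>k\<bar> - 1) ` J)"
      by (simp only: sum.reindex[OF J(3)] comp_def)
    also have "\<dots> \<le> suminf ?s"
      using finite_subset[OF J(1) assms(3)]
      by (intro sum_le_suminf summable_pow32) (auto simp: pow32_nonneg)
    finally show ?thesis .
  qed
  have "K \<subseteq> {0} \<union> (K \<inter> {0<..}) \<union> (K \<inter> {..<0})" by auto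
  then have "(\<Sum>k\<in>K. pow32 (norm (c k)))
      \<le> (\<Sum>k\<in>{0} \<union> (K \<inter> {0<..}) \<union> (K \<inter> {..<0}). pow32 (norm (c k)))"
    using assms(3) by (intro sum_mono2) (auto simp: pow32_nonneg)
  also have "\<dots> = pow32 (norm (c 0)) + (\<Sum>k\<in>K \<inter> {0<..}. pow32 (norm (c k)))
      + (\<Sum>k\<in>K \<inter> {..<0}. pow32 (norm (c k)))"
    using assms(3) by (subst sum.union_disjoint; force)+
  also have "\<dots> \<le> 1 + suminf ?s + suminf ?s"
    using pow32_mono[OF _ c1[of 0]] by (intro add_mono tail) (auto simp: inj_on_def)
  finally show ?thesis by (simp add: pow32_bound_def)
qed


section \<open>The binary tree\<close>

definition nodes :: "nat \<Rightarrow> bool list set" where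
  "nodes n = {w. length w < n}"

lemma finite_nodes [simp]: "finite (nodes n)"
proof -
  have "nodes n = (\<Union>j<n. {w. length w = j})" by (auto simp: nodes_def)
  moreover have "finite {w :: bool list. length w = j}" for j
    using finite_lists_length_eq[of "UNIV :: bool set" j] by simp
  ultimately show ?thesis by simp
qed

text \<open>Each of the \<open>n\<close> levels has total weight 1. The same sum is later the
  squared norm of all packets together and twice the mean number of right turns.\<close>

lemma sum_nodes_half_power: "(\<Sum>w\<in>nodes n. (1 / 2 :: real) ^ length w) = n"
proof (induction n)
  case (Suc n)
  have fin: "finite {w :: bool list. length w = n}" and
    card: "card {w :: bool list. length w = n} = 2 ^ n"
    using finite_lists_length_eq[of "UNIV :: bool set" n]
      card_lists_length_eq[of "UNIV :: bool set" n] by simp_all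
  have "nodes (Suc n) = nodes n \<union> {w. length w = n}" "nodes n \<inter> {w. length w = n} = {}"
    by (auto simp: nodes_def)
  then have "(\<Sum>w\<in>nodes (Suc n). (1 / 2 :: real) ^ length w)
      = (\<Sum>w\<in>nodes n. (1 / 2) ^ length w) + (\<Sum>w :: bool list | length w = n. (1 / 2) ^ length w)"
    using fin by (simp only: sum.union_disjoint finite_nodes)
  also have "(\<Sum>w :: bool list | length w = n. (1 / 2 :: real) ^ length w) = 2 ^ n * (1 / 2) ^ n"
    using card by simp
  finally show ?case using Suc by (simp add: power_divide)
qed (simp add: nodes_def)

lemma card_nodes_le: "card (nodes n) \<le> 2 ^ n"
proof (induction n)
  case (Suc n)
  have "card {w :: bool list. length w = n} = 2 ^ n"
    using card_lists_length_eq[of "UNIV :: bool set" n] by simp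
  moreover have "nodes (Suc n) = nodes n \<union> {w. length w = n}" by (auto simp: nodes_def)
  ultimately have "card (nodes (Suc n)) \<le> card (nodes n) + 2 ^ n"
    by (metis card_Un_le)
  then show ?case using Suc by simp
qed (simp add: nodes_def)

primrec descent :: "(bool list \<Rightarrow> bool) \<Rightarrow> nat \<Rightarrow> bool list" where
  "descent s 0 = []"
| "descent s (Suc j) = descent s j @ [s (descent s j)]"

lemma length_descent [simp]: "length (descent s j) = j"
  by (induction j) auto

text \<open>Passing through \<open>w\<close> is a conjunction of independent conditions, one for
  each proper ancestor. This is what allows a product formula for the packets.\<close>

lemma descent_eq_iff:
  "descent s (length w) = w \<longleftrightarrow> (\<forall>u. strict_prefix u w \<longrightarrow> s u = w ! length u)"
proof (induction w rule: rev_induct)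
  case (snoc b w)
  have "(\<forall>u. strict_prefix u (w @ [b]) \<longrightarrow> s u = (w @ [b]) ! length u) \<longleftrightarrow>
        s w = b \<and> (\<forall>u. strict_prefix u w \<longrightarrow> s u = w ! length u)"
  proof -
    have 1: "strict_prefix u (w @ [b]) \<longleftrightarrow> u = w \<or> strict_prefix u w" for u
      unfolding strict_prefix_def prefix_snoc by (auto dest: prefix_length_le)
    have 2: "(w @ [b]) ! length u = w ! length u" if "strict_prefix u w" for u
      using prefix_length_less[OF that] by (simp add: nth_append)
    have "(w @ [b]) ! length w = b" by simp
    with 2 show ?thesis unfolding 1 by metis
  qed
  then show ?case using snoc by auto
qed simp

lemma descent_extend: "i < j \<Longrightarrow> \<exists>r. descent s j = descent s i @ s (descent s i) # r"
proof (induction j)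
  case (Suc j)
  then show ?case by (cases "i = j") auto
qed simp

text \<open>In-order position in the complete binary tree whose leaves are the words of length \<open>n\<close>.\<close>

fun inpos :: "nat \<Rightarrow> bool list \<Rightarrow> nat" where
  "inpos n [] = 2 ^ n"
| "inpos n (b # w) = (if b then 2 ^ n else 0) + inpos (n - 1) w"

lemma inpos_bounds: "length w \<le> n \<Longrightarrow> 0 < inpos n w \<and> inpos n w < 2 ^ Suc n"
proof (induction w arbitrary: n)
  case (Cons b w)
  then obtain m where "n = Suc m" by (cases n) auto
  with Cons show ?case by fastforce
qed simp

text \<open>Stripping the common prefix subtracts the same amount from both positions. Then
  \<open>w\<close> becomes the root, and the first letter \<open>b\<close> decides the side on which
  the descendant lies.\<close>

lemma inpos_less_iff: "length (w @ b # r) \<le> n \<Longrightarrow> inpos n w < inpos n (w @ b # r) \<longleftrightarrow> b"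
proof (induction w arbitrary: n)
  case Nil
  then obtain m where "n = Suc m" by (cases n) auto
  then show ?case using inpos_bounds[of r m] Nil by auto
next
  case (Cons a w)
  then obtain m where "n = Suc m" by (cases n) auto
  then show ?case using Cons by auto
qed

lemma inpos_descent_less_iff:
  assumes "j < n"
  shows "inpos n (descent s j) < inpos n (descent s n) \<longleftrightarrow> s (descent s j)"
proof -
  obtain r where r: "descent s n = descent s j @ s (descent s j) # r"
    using descent_extend[OF assms] by blast
  then have "length (descent s j @ s (descent s j) # r) \<le> n" by (metis length_descent order_refl)
  from inpos_less_iff[OF this] show ?thesis by (simp add: r)
qed

subsection \<open>Wave packets indexed by the nodes\<close>

text \<open>At a proper ancestor \<open>u\<close> the factor is the indicator that the sign at
  \<open>u\<close> points to the next letter of \<open>w\<close>. Writing it as an affine function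
  of \<open>sqw\<close> makes its Fourier coefficients explicit.\<close>

definition node_factor :: "nat \<Rightarrow> bool list \<Rightarrow> bool list \<Rightarrow> int \<Rightarrow> real" where
  "node_factor Q w u y =
     (if u = w then sqw Q y
      else if strict_prefix u w then (1 + (if w ! length u then 1 else - 1) * sqw Q y) / 2
      else 1)"

lemma abs_node_factor_le: "\<bar>node_factor Q w u y\<bar> \<le> 1"
  by (auto simp: node_factor_def sqw_def)

definition packet :: "nat \<Rightarrow> nat \<Rightarrow> bool list \<Rightarrow> (bool list \<Rightarrow> int) \<Rightarrow> real" where
  "packet Q n w y = (\<Prod>u\<in>nodes n. node_factor Q w u (y u))"

text \<open>The Fourier coefficients of \<open>packet\<close> on the product group: as the packet is
  a product of functions of single coordinates, they factor as well.\<close>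

definition pcoeff :: "nat \<Rightarrow> nat \<Rightarrow> bool list \<Rightarrow> (bool list \<Rightarrow> int) \<Rightarrow> complex" where
  "pcoeff Q n w k = (\<Prod>u\<in>nodes n. cyc_coeff Q (node_factor Q w u) (k u))"

lemma strict_prefix_nodes: "strict_prefix u w \<Longrightarrow> w \<in> nodes n \<Longrightarrow> u \<in> nodes n"
  by (auto simp: nodes_def dest: prefix_length_less)

text \<open>The ancestor factors take the values 0 and 1, and by \<open>descent_eq_iff\<close> they
  are all 1 exactly when the descent reaches \<open>w\<close>.\<close>

lemma packet_eq:
  assumes "w \<in> nodes n"
  shows "packet Q n w y
       = (if descent (\<lambda>u. half Q (y u)) (length w) = w then sqw Q (y w) else 0)"
proof -
  let ?s = "\<lambda>u. half Q (y u)"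
  have "packet Q n w y = sqw Q (y w) * (\<Prod>u\<in>nodes n - {w}. node_factor Q w u (y u))"
    unfolding packet_def by (subst prod.remove[OF _ assms]) (simp_all add: node_factor_def)
  also have "(\<Prod>u\<in>nodes n - {w}. node_factor Q w u (y u))
      = (\<Prod>u\<in>nodes n - {w}. if strict_prefix u w \<longrightarrow> ?s u = w ! length u then 1 else 0)"
    by (intro prod.cong refl) (auto simp: node_factor_def sqw_def)
  also have "\<dots> = (if descent ?s (length w) = w then 1 else 0)"
  proof (cases "descent ?s (length w) = w")
    case True
    then have "\<And>u. strict_prefix u w \<Longrightarrow> ?s u = w ! length u"
      unfolding descent_eq_iff by blast
    then have "(\<Prod>u\<in>nodes n - {w}. if strict_prefix u w \<longrightarrow> ?s u = w ! length u then 1 else 0 :: real) = 1"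
      by (intro prod.neutral) simp
    then show ?thesis using True by simp
  next
    case False
    then obtain u where u: "strict_prefix u w" "?s u \<noteq> w ! length u"
      unfolding descent_eq_iff by blast
    then have "u \<in> nodes n - {w}" using strict_prefix_nodes[OF _ assms] by auto
    then have "(\<Prod>u\<in>nodes n - {w}. if strict_prefix u w \<longrightarrow> ?s u = w ! length u then 1 else 0 :: real) = 0"
      using u by (intro prod_zero) (auto intro!: bexI[of _ u])
    then show ?thesis using False by simp
  qed
  finally show ?thesis by simp
qed



lemma sum_prod_nodes:
  fixes g :: "bool list \<Rightarrow> int \<Rightarrow> 'a :: comm_semiring_1"
  assumes "finite Z"
  shows "(\<Sum>y\<in>PiE (nodes n) (\<lambda>_. Z). \<Prod>u\<in>nodes n. g u (y u)) = (\<Prod>u\<in>nodes n. \<Sum>z\<in>Z. g u z)"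
  by (rule prod_sum_PiE[where A = "nodes n" and B = "\<lambda>_. Z" and f = g, symmetric]) (simp_all add: assms)

lemma packet_inversion:
  assumes "Q > 0" "y \<in> PiE (nodes n) (\<lambda>_. {0..<int Q})"
  shows "(\<Sum>k\<in>PiE (nodes n) (\<lambda>_. dual Q). pcoeff Q n w k * chr Q (\<Sum>u\<in>nodes n. k u * y u))
       = of_real (packet Q n w y)"
proof -
  let ?g = "\<lambda>u k. cyc_coeff Q (node_factor Q w u) k * chr Q (k * y u)"
  have "(\<Sum>k\<in>PiE (nodes n) (\<lambda>_. dual Q). pcoeff Q n w k * chr Q (\<Sum>u\<in>nodes n. k u * y u))
      = (\<Sum>k\<in>PiE (nodes n) (\<lambda>_. dual Q). \<Prod>u\<in>nodes n. ?g u (k u))"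
    by (simp only: pcoeff_def chr_sum prod.distrib)
  also have "\<dots> = (\<Prod>u\<in>nodes n. \<Sum>k\<in>dual Q. ?g u k)"
    by (rule sum_prod_nodes[where g = ?g]) simp
  also have "\<dots> = (\<Prod>u\<in>nodes n. of_real (node_factor Q w u (y u)))"
    by (intro prod.cong refl cyc_inversion assms(1) PiE_mem[OF assms(2)])
  finally show ?thesis by (simp add: packet_def)
qed

lemma sum_sqw:
  assumes "even Q" "Q > 0"
  shows "(\<Sum>z\<in>{0..<int Q}. sqw Q z) = 0"
proof -
  have "complex_of_real (\<Sum>z\<in>{0..<int Q}. sqw Q z) = 0"
    using cyc_coeff_sqw(2)[OF assms zero_in_dual[OF assms(2)]] assms(2)
    by (simp add: cyc_coeff_def)
  then show ?thesis by (simp only: of_real_eq_0_iff)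
qed

lemma sum_packet:
  assumes "even Q" "Q > 0" "w \<in> nodes n"
  shows "(\<Sum>y\<in>PiE (nodes n) (\<lambda>_. {0..<int Q}). packet Q n w y) = 0"
proof -
  have "(\<Sum>y\<in>PiE (nodes n) (\<lambda>_. {0..<int Q}). packet Q n w y)
      = (\<Prod>u\<in>nodes n. \<Sum>z\<in>{0..<int Q}. node_factor Q w u z)"
    unfolding packet_def by (rule sum_prod_nodes) simp
  also have "\<dots> = 0"
    using assms(3) sum_sqw[OF assms(1,2)]
    by (intro prod_zero bexI[of _ w]) (simp_all add: node_factor_def)
  finally show ?thesis .
qed

lemma card_strict_prefixes:
  assumes "w \<in> nodes n"
  shows "card {u \<in> nodes n. strict_prefix u w} = length w"
proof -
  have "{u \<in> nodes n. strict_prefix u w} = (\<lambda>i. take i w) ` {..<length w}"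
  proof (intro equalityI subsetI)
    fix u assume "u \<in> {u \<in> nodes n. strict_prefix u w}"
    then show "u \<in> (\<lambda>i. take i w) ` {..<length w}"
      by (intro image_eqI[of _ _ "length u"]) (auto simp: prefix_def strict_prefix_def prefix_length_less)
  next
    fix u assume "u \<in> (\<lambda>i. take i w) ` {..<length w}"
    then obtain i where i: "i < length w" "u = take i w" by auto
    then have "strict_prefix u w"
      by (metis length_take min.absorb4 nat_neq_iff prefix_order.le_imp_less_or_eq take_is_prefix)
    then show "u \<in> {u \<in> nodes n. strict_prefix u w}"
      using strict_prefix_nodes[OF _ assms] by simp
  qed
  moreover have "inj_on (\<lambda>i. take i w) {..<length w}"
    by (rule inj_onI) (metis lessThan_iff length_take min.absorb4)
  ultimately show ?thesis by (simp add: card_image)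
qed

lemma prod_nodes_if_strict_prefix:
  assumes "w \<in> nodes n"
  shows "(\<Prod>u\<in>nodes n. if strict_prefix u w then c else (1::real)) = c ^ length w"
  by (simp add: prod.If_cases card_strict_prefixes[OF assms] Int_def)

text \<open>The coordinates separate. Squaring leaves an indicator of density \<open>1 / 2\<close>
  at each of the \<open>length w\<close> proper ancestors and the constant 1 elsewhere.\<close>

lemma sum_packet_squared:
  assumes "even Q" "Q > 0" "w \<in> nodes n"
  shows "(\<Sum>y\<in>PiE (nodes n) (\<lambda>_. {0..<int Q}). (packet Q n w y)\<^sup>2)
       = of_nat (Q ^ card (nodes n)) * (1 / 2) ^ length w"
proof -
  have "(\<Sum>z\<in>{0..<int Q}. (node_factor Q w u z)\<^sup>2) = of_nat Q * (if strict_prefix u w then 1 / 2 else 1)" for u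
  proof -
    let ?e = "if w ! length u then 1 else - 1 :: real"
    have "(node_factor Q w u z)\<^sup>2 = (if strict_prefix u w then 1 / 2 + ?e / 2 * sqw Q z else 1)" for z
      by (auto simp: node_factor_def sqw_def)
    then show ?thesis
      by (cases "strict_prefix u w")
         (simp_all add: sum.distrib sum_subtractf sum_negf sum_sqw[OF assms(1,2)] flip: sum_divide_distrib)
  qed
  moreover have "(\<Sum>y\<in>PiE (nodes n) (\<lambda>_. {0..<int Q}). (packet Q n w y)\<^sup>2)
     = (\<Prod>u\<in>nodes n. \<Sum>z\<in>{0..<int Q}. (node_factor Q w u z)\<^sup>2)"
    unfolding packet_def prod_power_distrib
    by (rule sum_prod_nodes[where g = "\<lambda>u z. (node_factor Q w u z)\<^sup>2"]) simp
  ultimately have "(\<Sum>y\<in>PiE (nodes n) (\<lambda>_. {0..<int Q}). (packet Q n w y)\<^sup>2)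
     = (\<Prod>u\<in>nodes n. of_nat Q * (if strict_prefix u w then 1 / 2 else 1))" by simp
  then show ?thesis
    by (simp only: prod.distrib prod_nodes_if_strict_prefix[OF assms(3)]) simp
qed

text \<open>A packet \<open>p\<close> with values in \<open>{-1, 0, 1}\<close> contributes exactly
  when it equals 1: off the path it vanishes, and on the path the leaf comes later iff the sign is
  positive. Hence the contribution is \<open>(p\<^sup>2 + p) / 2\<close>, where the linear part has
  mean zero and the squares have means adding up to \<open>n\<close>.\<close>

lemma sum_right_turns:
  assumes "even Q" "Q > 0"
  shows "(\<Sum>y\<in>PiE (nodes n) (\<lambda>_. {0..<int Q}).
           \<Sum>w | w \<in> nodes n \<and> inpos n w < inpos n (descent (\<lambda>u. half Q (y u)) n). packet Q n w y)
       = of_nat (Q ^ card (nodes n)) * (n / 2)"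
proof -
  let ?Y = "PiE (nodes n) (\<lambda>_. {0..<int Q})"
  have "(\<Sum>w | w \<in> nodes n \<and> inpos n w < inpos n (descent (\<lambda>u. half Q (y u)) n). packet Q n w y)
      = (\<Sum>w\<in>nodes n. ((packet Q n w y)\<^sup>2 + packet Q n w y) / 2)" for y
  proof -
    let ?s = "\<lambda>u. half Q (y u)"
    have "(\<Sum>w | w \<in> nodes n \<and> inpos n w < inpos n (descent ?s n). packet Q n w y)
      = (\<Sum>w\<in>nodes n. if inpos n w < inpos n (descent ?s n) then packet Q n w y else 0)"
      by (simp add: sum.If_cases Int_def)
    also have "\<dots> = (\<Sum>w\<in>nodes n. ((packet Q n w y)\<^sup>2 + packet Q n w y) / 2)"
    proof (intro sum.cong refl)
      fix w assume w: "w \<in> nodes n"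
      show "(if inpos n w < inpos n (descent ?s n) then packet Q n w y else 0)
          = ((packet Q n w y)\<^sup>2 + packet Q n w y) / 2"
      proof (cases "descent ?s (length w) = w")
        case True
        then have "inpos n w < inpos n (descent ?s n) \<longleftrightarrow> ?s w"
          using inpos_descent_less_iff[of "length w" n ?s] w by (simp add: nodes_def)
        then show ?thesis using True by (simp add: packet_eq[OF w] sqw_def)
      qed (simp add: packet_eq[OF w])
    qed
    finally show ?thesis .
  qed
  then have "(\<Sum>y\<in>?Y. \<Sum>w | w \<in> nodes n \<and> inpos n w < inpos n (descent (\<lambda>u. half Q (y u)) n). packet Q n w y)
     = (\<Sum>y\<in>?Y. \<Sum>w\<in>nodes n. ((packet Q n w y)\<^sup>2 + packet Q n w y) / 2)" by simp
  also have "\<dots> = (\<Sum>w\<in>nodes n. \<Sum>y\<in>?Y. ((packet Q n w y)\<^sup>2 + packet Q n w y) / 2)"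
    by (rule sum.swap)
  also have "\<dots> = (\<Sum>w\<in>nodes n. ((\<Sum>y\<in>?Y. (packet Q n w y)\<^sup>2) + (\<Sum>y\<in>?Y. packet Q n w y)) / 2)"
    by (simp only: sum.distrib sum_divide_distrib[symmetric])
  also have "\<dots> = (\<Sum>w\<in>nodes n. of_nat (Q ^ card (nodes n)) / 2 * (1 / 2) ^ length w)"
    by (simp add: sum_packet[OF assms] sum_packet_squared[OF assms])
  also have "\<dots> = of_nat (Q ^ card (nodes n)) / 2 * n"
    unfolding sum_distrib_left[symmetric] sum_nodes_half_power ..
  finally show ?thesis by simp
qed

lemma sum_pcoeff_squared:
  assumes "even Q" "Q > 0" "w \<in> nodes n"
  shows "(\<Sum>k\<in>PiE (nodes n) (\<lambda>_. dual Q). (norm (pcoeff Q n w k))\<^sup>2) = (1 / 2) ^ length w"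
proof -
  let ?K = "PiE (nodes n) (\<lambda>_. dual Q)" and ?Y = "PiE (nodes n) (\<lambda>_. {0..<int Q})"
  have "of_nat (Q ^ card (nodes n)) * (\<Sum>k\<in>?K. (norm (pcoeff Q n w k))\<^sup>2)
      = (\<Sum>y\<in>?Y. (norm (\<Sum>k\<in>?K. pcoeff Q n w k * chr Q (\<Sum>u\<in>nodes n. k u * y u)))\<^sup>2)"
    by (rule parseval_PiE[OF finite_nodes assms(2) order_refl, symmetric, where \<beta> = "pcoeff Q n w"])
  also have "\<dots> = (\<Sum>y\<in>?Y. (packet Q n w y)\<^sup>2)"
  proof (rule sum.cong[OF refl])
    fix y assume "y \<in> ?Y"
    from packet_inversion[OF assms(2) this, of w]
    show "(norm (\<Sum>k\<in>?K. pcoeff Q n w k * chr Q (\<Sum>u\<in>nodes n. k u * y u)))\<^sup>2 = (packet Q n w y)\<^sup>2"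
      by (simp only: norm_of_real power2_abs)
  qed
  also have "\<dots> = of_nat (Q ^ card (nodes n)) * (1 / 2) ^ length w"
    by (rule sum_packet_squared[OF assms])
  finally show ?thesis using assms(2) by (simp del: of_nat_power)
qed


subsection \<open>Truncation by the size of the coefficients\<close>

lemma node_factor_self: "node_factor Q w w = sqw Q"
  by (simp add: node_factor_def fun_eq_iff)

lemma node_factor_strict_prefix:
  "strict_prefix u w \<Longrightarrow>
     node_factor Q w u = (\<lambda>z. 1 / 2 + (if w ! length u then 1 / 2 else - 1 / 2) * sqw Q z)"
  by (auto simp: node_factor_def fun_eq_iff field_simps)

lemma node_factor_not_prefix: "\<not> prefix u w \<Longrightarrow> node_factor Q w u = (\<lambda>_. 1)"
  by (auto simp: node_factor_def fun_eq_iff)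

lemma norm_cyc_coeff_node_factor:
  assumes "even Q" "Q > 0" "k \<in> dual Q"
  shows "norm (cyc_coeff Q (node_factor Q w u) k) * of_int \<bar>k\<bar> \<le> 2"
proof (cases "k = 0")
  case False
  note 1 = cyc_coeff_1[OF assms(2,3)] and s = cyc_coeff_sqw(1)[OF assms]
  consider "u = w" | "strict_prefix u w" | "\<not> prefix u w"
    by (auto simp: strict_prefix_def)
  then show ?thesis
  proof cases
    case 2
    have "cyc_coeff Q (node_factor Q w u) k
        = of_real (if w ! length u then 1 / 2 else - 1 / 2) * cyc_coeff Q (sqw Q) k"
      unfolding node_factor_strict_prefix[OF 2] cyc_coeff_affine 1 using False by simp
    then have "norm (cyc_coeff Q (node_factor Q w u) k) = 1 / 2 * norm (cyc_coeff Q (sqw Q) k)"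
      by (simp add: norm_mult)
    then have "norm (cyc_coeff Q (node_factor Q w u) k) * of_int \<bar>k\<bar>
        = 1 / 2 * (norm (cyc_coeff Q (sqw Q) k) * of_int \<bar>k\<bar>)" by simp
    then show ?thesis using s by linarith
  qed (use s False in \<open>simp_all add: node_factor_self node_factor_not_prefix 1\<close>)
qed simp

text \<open>The sum is a product over the nodes, in which only \<open>w\<close> and its ancestors
  contribute a factor other than 1. These are at most \<open>n\<close> factors, so the bound is
  exponential in the depth and not in the number of nodes.\<close>

lemma sum_pow32_pcoeff:
  assumes "even Q" "Q > 0" "w \<in> nodes n"
  shows "(\<Sum>k\<in>PiE (nodes n) (\<lambda>_. dual Q). pow32 (norm (pcoeff Q n w k))) \<le> pow32_bound ^ n"
proof -
  let ?s = "\<lambda>u. \<Sum>k\<in>dual Q. pow32 (norm (cyc_coeff Q (node_factor Q w u) k))"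
  have "(\<Sum>k\<in>PiE (nodes n) (\<lambda>_. dual Q). pow32 (norm (pcoeff Q n w k)))
      = (\<Sum>k\<in>PiE (nodes n) (\<lambda>_. dual Q). \<Prod>u\<in>nodes n. pow32 (norm (cyc_coeff Q (node_factor Q w u) (k u))))"
    by (simp only: pcoeff_def pow32_prod prod_norm[symmetric])
  also have "\<dots> = (\<Prod>u\<in>nodes n. ?s u)"
    by (rule sum_prod_nodes[where g = "\<lambda>u k. pow32 (norm (cyc_coeff Q (node_factor Q w u) k))"]) simp
  also have "\<dots> \<le> (\<Prod>u\<in>nodes n. (if u = w then pow32_bound else 1) * (if strict_prefix u w then pow32_bound else 1))"
  proof (intro prod_mono conjI sum_nonneg pow32_nonneg norm_ge_zero)
    fix u
    have B: "?s u \<le> pow32_bound"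
      using norm_cyc_coeff_node_factor[OF assms(1,2)]
      by (intro sum_pow32_le norm_cyc_coeff_le_1 abs_node_factor_le) auto
    have "?s u = (\<Sum>k\<in>dual Q. if k = 0 then 1 else 0)" if "\<not> prefix u w"
      unfolding node_factor_not_prefix[OF that] by (intro sum.cong) (simp_all add: cyc_coeff_1[OF assms(2)])
    then have "?s u = 1" if "\<not> prefix u w"
      using that zero_in_dual[OF assms(2)] by simp
    then show "?s u \<le> (if u = w then pow32_bound else 1) * (if strict_prefix u w then pow32_bound else 1)"
      using B by (auto simp: strict_prefix_def)
  qed
  also have "\<dots> = pow32_bound ^ Suc (length w)"
    unfolding prod.distrib prod_nodes_if_strict_prefix[OF assms(3)] using assms(3) by simp
  also have "\<dots> \<le> pow32_bound ^ n"
    using assms(3) pow32_bound_ge_1 by (intro power_increasing) (auto simp: nodes_def)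
  finally show ?thesis .
qed

definition large_coeffs :: "real \<Rightarrow> nat \<Rightarrow> nat \<Rightarrow> bool list \<Rightarrow> (bool list \<Rightarrow> int) set" where
  "large_coeffs \<theta> Q n w = {k \<in> PiE (nodes n) (\<lambda>_. dual Q). \<theta> \<le> norm (pcoeff Q n w k)}"

lemma finite_PiE_dual [simp]: "finite (PiE (nodes n) (\<lambda>_. dual Q))"
  by (intro finite_PiE) auto

lemma finite_large_coeffs [simp]: "finite (large_coeffs \<theta> Q n w)"
  by (rule finite_subset[of _ "PiE (nodes n) (\<lambda>_. dual Q)"]) (auto simp: large_coeffs_def)

text \<open>Chebyshev's inequality for the sum of the powers 3/2.\<close>

lemma card_large_coeffs_le:
  assumes "even Q" "Q > 0" "w \<in> nodes n" "\<theta> > 0"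
  shows "card (large_coeffs \<theta> Q n w) * pow32 \<theta> \<le> pow32_bound ^ n"
proof -
  have "card (large_coeffs \<theta> Q n w) * pow32 \<theta> = (\<Sum>k\<in>large_coeffs \<theta> Q n w. pow32 \<theta>)" by simp
  also have "\<dots> \<le> (\<Sum>k\<in>large_coeffs \<theta> Q n w. pow32 (norm (pcoeff Q n w k)))"
    using assms(4) by (intro sum_mono pow32_mono) (auto simp: large_coeffs_def)
  also have "\<dots> \<le> (\<Sum>k\<in>PiE (nodes n) (\<lambda>_. dual Q). pow32 (norm (pcoeff Q n w k)))"
    by (intro sum_mono2) (auto simp: large_coeffs_def pow32_nonneg)
  also have "\<dots> \<le> pow32_bound ^ n" by (rule sum_pow32_pcoeff[OF assms(1-3)])
  finally show ?thesis .
qed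

text \<open>A square is the power 3/2 times a square root, and below the threshold that square root
  is at most \<open>sqrt \<theta>\<close>.\<close>

lemma sum_small_coeffs_le:
  assumes "even Q" "Q > 0" "w \<in> nodes n" "\<theta> \<ge> 0"
  shows "(\<Sum>k\<in>PiE (nodes n) (\<lambda>_. dual Q) - large_coeffs \<theta> Q n w. (norm (pcoeff Q n w k))\<^sup>2) \<le> sqrt \<theta> * pow32_bound ^ n"
proof -
  let ?K = "PiE (nodes n) (\<lambda>_. dual Q)"
  have "(\<Sum>k\<in>?K - large_coeffs \<theta> Q n w. (norm (pcoeff Q n w k))\<^sup>2)
      \<le> (\<Sum>k\<in>?K - large_coeffs \<theta> Q n w. sqrt \<theta> * pow32 (norm (pcoeff Q n w k)))"
  proof (rule sum_mono)
    fix k assume "k \<in> ?K - large_coeffs \<theta> Q n w"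
    then have "norm (pcoeff Q n w k) \<le> \<theta>" by (auto simp: large_coeffs_def)
    then have "sqrt (norm (pcoeff Q n w k)) * pow32 (norm (pcoeff Q n w k))
        \<le> sqrt \<theta> * pow32 (norm (pcoeff Q n w k))"
      by (intro mult_right_mono) (auto simp: pow32_nonneg)
    moreover have "sqrt (norm (pcoeff Q n w k)) * pow32 (norm (pcoeff Q n w k)) = (norm (pcoeff Q n w k))\<^sup>2"
      by (simp add: pow32_def power2_eq_square)
    ultimately show "(norm (pcoeff Q n w k))\<^sup>2 \<le> sqrt \<theta> * pow32 (norm (pcoeff Q n w k))" by simp
  qed
  also have "\<dots> = sqrt \<theta> * (\<Sum>k\<in>?K - large_coeffs \<theta> Q n w. pow32 (norm (pcoeff Q n w k)))"
    by (simp add: sum_distrib_left)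
  also have "\<dots> \<le> sqrt \<theta> * pow32_bound ^ n"
  proof -
    have "(\<Sum>k\<in>?K - large_coeffs \<theta> Q n w. pow32 (norm (pcoeff Q n w k))) \<le> (\<Sum>k\<in>?K. pow32 (norm (pcoeff Q n w k)))"
      by (intro sum_mono2) (auto simp: pow32_nonneg)
    also have "\<dots> \<le> pow32_bound ^ n" by (rule sum_pow32_pcoeff[OF assms(1-3)])
    finally show ?thesis using assms(4) by (intro mult_left_mono) auto
  qed
  finally show ?thesis .
qed

definition tpacket :: "real \<Rightarrow> nat \<Rightarrow> nat \<Rightarrow> bool list \<Rightarrow> (bool list \<Rightarrow> int) \<Rightarrow> complex" where
  "tpacket \<theta> Q n w y = (\<Sum>k\<in>large_coeffs \<theta> Q n w. pcoeff Q n w k * chr Q (\<Sum>u\<in>nodes n. k u * y u))"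

text \<open>The error is the Fourier sum over the discarded frequencies. Cauchy-Schwarz passes to
  its square mean, and Parseval to the squares of the small coefficients.\<close>

lemma sum_norm_tpacket_diff:
  assumes "even Q" "Q > 0" "w \<in> nodes n" "\<theta> \<ge> 0"
  shows "(\<Sum>y\<in>PiE (nodes n) (\<lambda>_. {0..<int Q}). norm (tpacket \<theta> Q n w y - of_real (packet Q n w y)))
      \<le> of_nat (Q ^ card (nodes n)) * sqrt (sqrt \<theta> * pow32_bound ^ n)"
proof -
  let ?K = "PiE (nodes n) (\<lambda>_. dual Q)" and ?Y = "PiE (nodes n) (\<lambda>_. {0..<int Q})"
  let ?D = "\<lambda>y. \<Sum>k\<in>?K - large_coeffs \<theta> Q n w. pcoeff Q n w k * chr Q (\<Sum>u\<in>nodes n. k u * y u)"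
  have "large_coeffs \<theta> Q n w \<subseteq> ?K" by (auto simp: large_coeffs_def)
  then have diff: "norm (tpacket \<theta> Q n w y - of_real (packet Q n w y)) = norm (?D y)" if "y \<in> ?Y" for y
    unfolding tpacket_def packet_inversion[OF assms(2) that, symmetric]
    by (subst sum.subset_diff[of "large_coeffs \<theta> Q n w" ?K]) simp_all
  have card: "card ?Y = Q ^ card (nodes n)" by (simp add: card_PiE)
  have "(\<Sum>y\<in>?Y. norm (tpacket \<theta> Q n w y - of_real (packet Q n w y))) = (\<Sum>y\<in>?Y. norm (?D y))"
    by (intro sum.cong refl diff)
  also have "\<dots> \<le> sqrt (of_nat (card ?Y) * (\<Sum>y\<in>?Y. (norm (?D y))\<^sup>2))"
    by (rule sum_norm_le_sqrt_card)
  also have "(\<Sum>y\<in>?Y. (norm (?D y))\<^sup>2)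
      = of_nat (Q ^ card (nodes n)) * (\<Sum>k\<in>?K - large_coeffs \<theta> Q n w. (norm (pcoeff Q n w k))\<^sup>2)"
    by (rule parseval_PiE[OF finite_nodes assms(2), where \<beta> = "pcoeff Q n w"]) auto
  also have "sqrt (of_nat (card ?Y) * (of_nat (Q ^ card (nodes n)) * (\<Sum>k\<in>?K - large_coeffs \<theta> Q n w. (norm (pcoeff Q n w k))\<^sup>2)))
      \<le> sqrt ((of_nat (Q ^ card (nodes n)))\<^sup>2 * (sqrt \<theta> * pow32_bound ^ n))"
    unfolding card power2_eq_square[of "of_nat (Q ^ card (nodes n))"] mult.assoc
    by (intro real_sqrt_le_mono mult_left_mono sum_small_coeffs_le assms) auto
  also have "\<dots> = of_nat (Q ^ card (nodes n)) * sqrt (sqrt \<theta> * pow32_bound ^ n)"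
    by (simp add: real_sqrt_mult)
  finally show ?thesis .
qed

text \<open>The untruncated packets give \<open>n / 2\<close> on average. The set of summed nodes
  depends on \<open>y\<close>, so the error is bounded in absolute value over all nodes, of which
  there are at most \<open>2 ^ n\<close>.\<close>

lemma sum_tpacket_right_turns_ge:
  assumes "even Q" "Q > 0" "\<theta> \<ge> 0"
  shows "of_nat (Q ^ card (nodes n)) * (n / 2 - 2 ^ n * sqrt (sqrt \<theta> * pow32_bound ^ n)) \<le>
    norm (\<Sum>y\<in>PiE (nodes n) (\<lambda>_. {0..<int Q}).
      \<Sum>w | w \<in> nodes n \<and> inpos n w < inpos n (descent (\<lambda>u. half Q (y u)) n). tpacket \<theta> Q n w y)"
    (is "?lhs \<le> norm ?Z")
proof -
  let ?Y = "PiE (nodes n) (\<lambda>_. {0..<int Q})"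
  let ?P = "\<lambda>y. {w. w \<in> nodes n \<and> inpos n w < inpos n (descent (\<lambda>u. half Q (y u)) n)}"
  let ?E = "\<lambda>w y. tpacket \<theta> Q n w y - of_real (packet Q n w y)"
  let ?c = "of_nat (Q ^ card (nodes n)) :: real" and ?e = "sqrt (sqrt \<theta> * pow32_bound ^ n)"
  define M where "M = (\<Sum>y\<in>?Y. \<Sum>w\<in>?P y. packet Q n w y)"
  have M: "M = ?c * (n / 2)"
    unfolding M_def by (rule sum_right_turns[OF assms(1,2)])
  have "norm (?Z - of_real M) = norm (\<Sum>y\<in>?Y. \<Sum>w\<in>?P y. ?E w y)"
    by (simp add: M_def sum_subtractf)
  also have "\<dots> \<le> (\<Sum>y\<in>?Y. \<Sum>w\<in>?P y. norm (?E w y))"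
    by (intro order_trans[OF norm_sum sum_mono] norm_sum)
  also have "\<dots> \<le> (\<Sum>y\<in>?Y. \<Sum>w\<in>nodes n. norm (?E w y))"
    by (intro sum_mono sum_mono2) auto
  also have "\<dots> = (\<Sum>w\<in>nodes n. \<Sum>y\<in>?Y. norm (?E w y))"
    by (rule sum.swap)
  also have "\<dots> \<le> (\<Sum>w\<in>nodes n. ?c * ?e)"
    by (intro sum_mono sum_norm_tpacket_diff assms)
  also have "\<dots> = card (nodes n) * (?c * ?e)" by simp
  also have "\<dots> \<le> 2 ^ n * (?c * ?e)"
  proof -
    have "real (card (nodes n)) \<le> real (2 ^ n)"
      using card_nodes_le[of n] by (simp only: of_nat_le_iff)
    then show ?thesis using assms(3) pow32_bound_ge_1 by (intro mult_right_mono) auto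
  qed
  finally have "norm (?Z - of_real M) \<le> 2 ^ n * (?c * ?e)" .
  moreover have "M \<le> norm (z - of_real M) + norm z" for z :: complex
    using norm_triangle_ineq4[of z "z - of_real M"] by simp
  then have "M \<le> norm (?Z - of_real M) + norm ?Z" .
  ultimately show ?thesis by (simp add: M algebra_simps)
qed

text \<open>All other factors of the coefficient have modulus at most 1, so the factor at
  \<open>u\<close> alone is at least \<open>\<theta>\<close>, and its decay limits
  \<open>k u\<close>.\<close>

lemma large_coeffs_coord_le:
  assumes "even Q" "Q > 0" "\<theta> > 0" "k \<in> large_coeffs \<theta> Q n w" "u \<in> nodes n"
  shows "\<theta> * of_int \<bar>k u\<bar> \<le> 2"
proof -
  have "\<theta> \<le> norm (pcoeff Q n w k)" using assms(4) by (simp add: large_coeffs_def)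
  also have "\<dots> = norm (cyc_coeff Q (node_factor Q w u) (k u)) *
      (\<Prod>v\<in>nodes n - {u}. norm (cyc_coeff Q (node_factor Q w v) (k v)))"
    unfolding pcoeff_def prod_norm[symmetric] by (rule prod.remove[OF finite_nodes assms(5)])
  also have "\<dots> \<le> norm (cyc_coeff Q (node_factor Q w u) (k u)) * 1"
    by (intro mult_left_mono prod_le_1 conjI norm_cyc_coeff_le_1 abs_node_factor_le) auto
  finally have "\<theta> * of_int \<bar>k u\<bar> \<le> norm (cyc_coeff Q (node_factor Q w u) (k u)) * of_int \<bar>k u\<bar>"
    by (intro mult_right_mono) auto
  also have "\<dots> \<le> 2"
    using assms(4,5) by (intro norm_cyc_coeff_node_factor assms(1,2)) (auto simp: large_coeffs_def dest: PiE_mem)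
  finally show ?thesis .
qed

lemma norm_pcoeff_le_1: "norm (pcoeff Q n w k) \<le> 1"
  unfolding pcoeff_def prod_norm[symmetric]
  by (intro prod_le_1 conjI norm_cyc_coeff_le_1 abs_node_factor_le) auto

text \<open>The node is recovered from a frequency vector as the longest node of its support.\<close>

lemma pcoeff_node_unique:
  assumes "even Q" "Q > 0" "k \<in> PiE (nodes n) (\<lambda>_. dual Q)"
    "w \<in> nodes n" "pcoeff Q n w k \<noteq> 0" "w' \<in> nodes n" "pcoeff Q n w' k \<noteq> 0"
  shows "w = w'"
proof -
  have self: "k v \<noteq> 0" if "v \<in> nodes n" "pcoeff Q n v k \<noteq> 0" for v
  proof
    assume "k v = 0"
    moreover have "cyc_coeff Q (node_factor Q v v) (k v) \<noteq> 0"
      using that by (auto simp: pcoeff_def)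
    ultimately show False
      using cyc_coeff_sqw(2)[OF assms(1,2) zero_in_dual[OF assms(2)]] by (simp add: node_factor_self)
  qed
  have supp: "prefix u v" if "u \<in> nodes n" "k u \<noteq> 0" "pcoeff Q n v k \<noteq> 0" for u v
  proof (rule ccontr)
    assume "\<not> prefix u v"
    moreover have "cyc_coeff Q (node_factor Q v u) (k u) \<noteq> 0"
      using that by (auto simp: pcoeff_def)
    ultimately show False
      using that cyc_coeff_1[OF assms(2) PiE_mem[OF assms(3) that(1)]] by (simp add: node_factor_not_prefix)
  qed
  have "prefix w w'" "prefix w' w"
    using assms self supp by blast+
  then show ?thesis by (rule prefix_order.antisym)
qed


section \<open>Random frequencies\<close>

text \<open>For a solution \<open>z\<close> the quotient \<open>\<bar>d\<bar> * z div Q\<close> is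
  exact, hence determines \<open>z\<close>, and it lies below \<open>\<bar>d\<bar>\<close>.\<close>

lemma card_zeros_mult_le:
  assumes "Q > 0" "d \<noteq> 0"
  shows "card {z \<in> {0..<int Q}. int Q dvd d * z} \<le> nat \<bar>d\<bar>"
proof -
  have "card {z \<in> {0..<int Q}. int Q dvd d * z} \<le> card {0..<\<bar>d\<bar>}"
  proof (rule card_inj_on_le[where f = "\<lambda>z. \<bar>d\<bar> * z div int Q"])
    have dvd: "int Q dvd \<bar>d\<bar> * z \<longleftrightarrow> int Q dvd d * z" for z
      by (cases "d \<ge> 0") auto
    show "inj_on (\<lambda>z. \<bar>d\<bar> * z div int Q) {z \<in> {0..<int Q}. int Q dvd d * z}"
    proof (rule inj_onI)
      fix z z' assume zs: "z \<in> {z \<in> {0..<int Q}. int Q dvd d * z}" "z' \<in> {z \<in> {0..<int Q}. int Q dvd d * z}"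
        and eq: "\<bar>d\<bar> * z div int Q = \<bar>d\<bar> * z' div int Q"
      have "\<bar>d\<bar> * z = \<bar>d\<bar> * z'"
        using zs eq dvd by (metis (mono_tags, lifting) dvd_mult_div_cancel mem_Collect_eq)
      then show "z = z'" using assms(2) by simp
    qed
    show "(\<lambda>z. \<bar>d\<bar> * z div int Q) ` {z \<in> {0..<int Q}. int Q dvd d * z} \<subseteq> {0..<\<bar>d\<bar>}"
    proof (rule image_subsetI)
      fix z assume "z \<in> {z \<in> {0..<int Q}. int Q dvd d * z}"
      then have z: "0 \<le> z" "z < int Q" by auto
      then have "\<bar>d\<bar> * z < \<bar>d\<bar> * int Q" using assms(2) by (intro mult_strict_left_mono) auto
      moreover have "\<bar>d\<bar> * z div int Q * int Q \<le> \<bar>d\<bar> * z"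
        by (simp add: minus_mod_eq_div_mult[symmetric] assms(1))
      ultimately have "\<bar>d\<bar> * z div int Q * int Q < \<bar>d\<bar> * int Q" by linarith
      then have "\<bar>d\<bar> * z div int Q < \<bar>d\<bar>"
        by (rule mult_right_less_imp_less) simp
      then show "\<bar>d\<bar> * z div int Q \<in> {0..<\<bar>d\<bar>}"
        using z assms(1) by (simp add: pos_imp_zdiv_nonneg_iff)
    qed
  qed simp
  then show ?thesis by simp
qed

text \<open>A fixed nontrivial relation holds mod \<open>Q\<close> with probability at most
  \<open>\<bar>d v\<bar> / Q\<close>. Divisibility is detected by averaging characters over
  \<open>j\<close>. Summing over \<open>m\<close> first keeps only those \<open>j\<close> that
  annihilate every \<open>d u\<close> mod \<open>Q\<close>, and the coordinate \<open>v\<close>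
  bounds their number.\<close>

lemma card_relation_le:
  assumes "finite A" "Q > 0" "v \<in> A" "d v \<noteq> 0"
  shows "Q * card {m \<in> PiE A (\<lambda>_. {0..<int Q}). int Q dvd (\<Sum>u\<in>A. d u * m u)}
       \<le> Q ^ card A * nat \<bar>d v\<bar>"
proof -
  let ?Y = "PiE A (\<lambda>_. {0..<int Q})" and ?s = "\<lambda>m. \<Sum>u\<in>A. d u * m u"
  let ?J = "{j \<in> {0..<int Q}. \<forall>u\<in>A. int Q dvd j * d u}"
  have fin: "finite ?Y" using assms(1) by (intro finite_PiE) auto
  have "of_nat (Q * card {m \<in> ?Y. int Q dvd ?s m}) = (\<Sum>m\<in>?Y. if int Q dvd ?s m then of_nat Q else 0 :: complex)"
    using fin by (simp add: sum.If_cases Int_def)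
  also have "\<dots> = (\<Sum>m\<in>?Y. \<Sum>j\<in>{0..<int Q}. chr Q (?s m * j))"
    using assms(2) by (simp only: sum_chr)
  also have "\<dots> = (\<Sum>j\<in>{0..<int Q}. \<Sum>m\<in>?Y. chr Q (?s m * j))"
    by (rule sum.swap)
  also have "\<dots> = (\<Sum>j\<in>{0..<int Q}. \<Sum>m\<in>?Y. chr Q (\<Sum>u\<in>A. (j * d u) * m u))"
    by (simp add: sum_distrib_left sum_distrib_right mult_ac)
  also have "\<dots> = (\<Sum>j\<in>{0..<int Q}. if \<forall>u\<in>A. int Q dvd j * d u then of_nat (Q ^ card A) else 0)"
    by (simp only: sum_chr_PiE[OF assms(1,2)])
  also have "\<dots> = of_nat (Q ^ card A * card ?J)"
    by (simp add: sum.If_cases Int_def)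
  finally have "Q * card {m \<in> ?Y. int Q dvd ?s m} = Q ^ card A * card ?J"
    by (simp only: of_nat_eq_iff)
  moreover have "card ?J \<le> card {j \<in> {0..<int Q}. int Q dvd d v * j}"
  proof (rule card_mono)
    show "finite {j \<in> {0..<int Q}. int Q dvd d v * j}"
      by (rule finite_subset[of _ "{0..<int Q}"]) auto
    show "?J \<subseteq> {j \<in> {0..<int Q}. int Q dvd d v * j}"
      using assms(3) by (auto simp: mult.commute)
  qed
  then have "card ?J \<le> nat \<bar>d v\<bar>"
    using card_zeros_mult_le[where d = "d v", OF assms(2,4)] by linarith
  ultimately show ?thesis by simp
qed

text \<open>The \<open>Suc\<close> moves the residues \<open>0..<Q\<close> to the admissible
  frequencies \<open>1..Q\<close>.\<close>

definition freq :: "nat \<Rightarrow> nat \<Rightarrow> int \<Rightarrow> (bool list \<Rightarrow> int) \<Rightarrow> (bool list \<Rightarrow> int) \<Rightarrow> nat" where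
  "freq Q n m0 m k = Suc (nat ((m0 + (\<Sum>u\<in>nodes n. k u * m u)) mod int Q))"

lemma freq_bounds: "Q > 0 \<Longrightarrow> freq Q n m0 m k \<in> {1..Q}"
  by (auto simp: freq_def Suc_le_eq nat_less_iff)

definition packet_index :: "real \<Rightarrow> nat \<Rightarrow> nat \<Rightarrow> (bool list \<times> (bool list \<Rightarrow> int)) set" where
  "packet_index \<theta> Q n = Sigma (nodes n) (large_coeffs \<theta> Q n)"

lemma finite_packet_index [simp]: "finite (packet_index \<theta> Q n)"
  by (simp add: packet_index_def)

definition collisions :: "real \<Rightarrow> nat \<Rightarrow> nat \<Rightarrow> int \<Rightarrow> (bool list \<Rightarrow> int) set" where
  "collisions \<theta> Q n m0 = {m \<in> PiE (nodes n) (\<lambda>_. {0..<int Q}).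
     \<not> inj_on (\<lambda>i. freq Q n m0 m (snd i)) (packet_index \<theta> Q n)}"

lemma finite_PiE_interval [simp]: "finite (PiE (nodes n) (\<lambda>_. {0..<int Q}))"
  by (intro finite_PiE) auto

text \<open>Union bound over pairs of indices. Two different indices have different frequency
  vectors, since the vector determines its node. A collision is therefore a nontrivial relation in
  which the shift \<open>m0\<close> cancels, and its coefficients are at most
  \<open>2 / \<theta> + 2 / \<theta>\<close>.\<close>

lemma card_collisions_le:
  assumes "even Q" "Q > 0" "\<theta> > 0"
  shows "real Q * card (collisions \<theta> Q n m0)
       \<le> (card (packet_index \<theta> Q n))\<^sup>2 * (real (Q ^ card (nodes n)) * (4 / \<theta>))"
proof -
  let ?Y = "PiE (nodes n) (\<lambda>_. {0..<int Q})" and ?I = "packet_index \<theta> Q n"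
  let ?R = "\<lambda>p. {m \<in> ?Y. int Q dvd (\<Sum>u\<in>nodes n. (snd (fst p) u - snd (snd p) u) * m u)}"
  let ?D = "{p \<in> ?I \<times> ?I. fst p \<noteq> snd p}"
  have sub: "collisions \<theta> Q n m0 \<subseteq> (\<Union>p\<in>?D. ?R p)"
  proof
    fix m assume m: "m \<in> collisions \<theta> Q n m0"
    then obtain i j where ij: "i \<in> ?I" "j \<in> ?I" "i \<noteq> j" "freq Q n m0 m (snd i) = freq Q n m0 m (snd j)"
      by (auto simp: collisions_def inj_on_def)
    let ?s = "\<lambda>k. \<Sum>u\<in>nodes n. k u * m u"
    have "(m0 + ?s (snd i)) mod int Q = (m0 + ?s (snd j)) mod int Q"
      using ij(4) assms(2) by (simp add: freq_def eq_nat_nat_iff)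
    then have "int Q dvd ?s (snd i) - ?s (snd j)"
      by (simp add: mod_eq_dvd_iff)
    then have "m \<in> ?R (i, j)"
      using m by (simp add: collisions_def sum_subtractf left_diff_distrib)
    moreover have "(i, j) \<in> ?D" using ij by simp
    ultimately show "m \<in> (\<Union>p\<in>?D. ?R p)" by (rule UN_I[rotated])
  qed
  have R: "real Q * card (?R p) \<le> real (Q ^ card (nodes n)) * (4 / \<theta>)" if p: "p \<in> ?D" for p
  proof -
    obtain w k w' k' where pd: "p = ((w, k), (w', k'))" by (cases p; cases "fst p"; cases "snd p") auto
    have in_large: "w \<in> nodes n" "k \<in> large_coeffs \<theta> Q n w" "w' \<in> nodes n" "k' \<in> large_coeffs \<theta> Q n w'"
      using p by (auto simp: pd packet_index_def)
    then have K: "k \<in> PiE (nodes n) (\<lambda>_. dual Q)" "k' \<in> PiE (nodes n) (\<lambda>_. dual Q)"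
      and ne: "pcoeff Q n w k \<noteq> 0" "pcoeff Q n w' k' \<noteq> 0"
      using assms(3) by (auto simp: large_coeffs_def)
    have "k \<noteq> k'"
      using p pcoeff_node_unique[OF assms(1,2) K(1) in_large(1) ne(1) in_large(3)] ne(2) by (auto simp: pd)
    then obtain v where v: "v \<in> nodes n" "k v \<noteq> k' v"
      using PiE_ext[OF K] by blast
    have "Q * card (?R p) \<le> Q ^ card (nodes n) * nat \<bar>k v - k' v\<bar>"
      using card_relation_le[OF finite_nodes assms(2) v(1), of "\<lambda>u. k u - k' u"] v(2)
      by (simp add: pd)
    then have "real (Q * card (?R p)) \<le> real (Q ^ card (nodes n) * nat \<bar>k v - k' v\<bar>)"
      by (simp only: of_nat_le_iff)
    also have "\<dots> = real (Q ^ card (nodes n)) * of_int \<bar>k v - k' v\<bar>" by simp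
    also have "\<dots> \<le> real (Q ^ card (nodes n)) * (4 / \<theta>)"
    proof (rule mult_left_mono)
      have "\<theta> * of_int \<bar>k v - k' v\<bar> \<le> \<theta> * (of_int \<bar>k v\<bar> + of_int \<bar>k' v\<bar>)"
        using assms(3) by (intro mult_left_mono) auto
      also have "\<dots> \<le> 2 + 2"
        unfolding distrib_left
        by (intro add_mono large_coeffs_coord_le[OF assms in_large(2) v(1)] large_coeffs_coord_le[OF assms in_large(4) v(1)])
      finally show "of_int \<bar>k v - k' v\<bar> \<le> 4 / \<theta>"
        using assms(3) by (simp add: field_simps)
    qed simp
    finally show ?thesis by simp
  qed
  have "real Q * card (collisions \<theta> Q n m0) \<le> real Q * card (\<Union>p\<in>?D. ?R p)"
    by (intro mult_left_mono of_nat_mono card_mono sub) auto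
  also have "\<dots> \<le> real Q * (\<Sum>p\<in>?D. card (?R p))"
    by (intro mult_left_mono of_nat_mono card_UN_le) auto
  also have "\<dots> = (\<Sum>p\<in>?D. real Q * card (?R p))"
    by (simp add: sum_distrib_left)
  also have "\<dots> \<le> (\<Sum>p\<in>?D. real (Q ^ card (nodes n)) * (4 / \<theta>))"
    by (rule sum_mono[OF R])
  also have "\<dots> \<le> (\<Sum>p\<in>?I \<times> ?I. real (Q ^ card (nodes n)) * (4 / \<theta>))"
    using assms(3) by (intro sum_mono2) auto
  also have "\<dots> = (card ?I)\<^sup>2 * (real (Q ^ card (nodes n)) * (4 / \<theta>))"
    by (simp add: card_cartesian_product power2_eq_square)
  finally show ?thesis .
qed

section \<open>Averages of the in-order partial sums over the random frequencies\<close>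

definition psum :: "real \<Rightarrow> nat \<Rightarrow> nat \<Rightarrow> int \<Rightarrow> (bool list \<Rightarrow> int) \<Rightarrow> nat \<Rightarrow> real \<Rightarrow> complex" where
  "psum \<theta> Q n m0 m T x =
     (\<Sum>w | w \<in> nodes n \<and> inpos n w < T. \<Sum>k\<in>large_coeffs \<theta> Q n w.
        pcoeff Q n w k * cis (2 * pi * freq Q n m0 m k * x))"

lemma descent_cong: "(\<And>u. u \<in> nodes j \<Longrightarrow> s u = s' u) \<Longrightarrow> descent s j = descent s' j"
  by (induction j) (auto simp: nodes_def)

lemma sum_shift_mod:
  assumes "Q > 0"
  shows "(\<Sum>z\<in>{0..<int Q}. F ((z + s) mod int Q)) = (\<Sum>z\<in>{0..<int Q}. F z)"
  by (rule sum.reindex_bij_witness[where i = "\<lambda>z. (z - s) mod int Q" and j = "\<lambda>z. (z + s) mod int Q"])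
     (use assms in \<open>auto simp: mod_simps\<close>)

text \<open>The condition on \<open>t\<close> keeps every phase in \<open>[0, pi / 3]\<close>, where
  the cosine is at least \<open>1 / 2\<close>; there is no cancellation.\<close>

lemma norm_sum_cis_ge:
  assumes "0 \<le> t" "t * real Q \<le> 1 / 6"
  shows "real Q / 2 \<le> norm (\<Sum>z\<in>{0..<int Q}. cis (2 * pi * Suc (nat z) * t))"
proof -
  have "1 / 2 \<le> Re (cis (2 * pi * Suc (nat z) * t))" if "z \<in> {0..<int Q}" for z
  proof -
    have "real (Suc (nat z)) * t \<le> real Q * t"
      using that assms(1) by (intro mult_right_mono) auto
    then have "real (Suc (nat z)) * t \<le> 1 / 6" using assms(2) by (simp add: mult.commute)
    then have "2 * pi * (real (Suc (nat z)) * t) \<le> 2 * pi * (1 / 6)"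
      by (intro mult_left_mono) auto
    then have "cos (pi / 3) \<le> cos (2 * pi * (real (Suc (nat z)) * t))"
      using assms(1) by (intro cos_monotone_0_pi_le) auto
    then show ?thesis by (simp add: cos_60 mult.assoc)
  qed
  then have "(\<Sum>z\<in>{0..<int Q}. 1 / 2) \<le> (\<Sum>z\<in>{0..<int Q}. Re (cis (2 * pi * Suc (nat z) * t)))"
    by (rule sum_mono)
  also have "\<dots> = Re (\<Sum>z\<in>{0..<int Q}. cis (2 * pi * Suc (nat z) * t))" by simp
  also have "\<dots> \<le> norm (\<Sum>z\<in>{0..<int Q}. cis (2 * pi * Suc (nat z) * t))"
    by (rule complex_Re_le_cmod)
  finally show ?thesis by simp
qed

lemma bij_betw_mult_PiE:
  assumes "Q > 0" "coprime a (int Q)"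
  shows "bij_betw (\<lambda>m. \<lambda>u\<in>nodes n. a * m u mod int Q)
           (PiE (nodes n) (\<lambda>_. {0..<int Q})) (PiE (nodes n) (\<lambda>_. {0..<int Q}))"
proof -
  let ?Y = "PiE (nodes n) (\<lambda>_. {0..<int Q})" and ?f = "\<lambda>m. \<lambda>u\<in>nodes n. a * m u mod int Q"
  have inj: "inj_on ?f ?Y"
  proof (rule inj_onI)
    fix m m' assume Y: "m \<in> ?Y" "m' \<in> ?Y" and eq: "?f m = ?f m'"
    show "m = m'"
    proof (rule PiE_ext[OF Y])
      fix u assume u: "u \<in> nodes n"
      have "a * m u mod int Q = a * m' u mod int Q"
        using fun_cong[OF eq, of u] u by simp
      then have "int Q dvd a * (m u - m' u)"
        by (simp add: mod_eq_dvd_iff right_diff_distrib)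
      then have "int Q dvd m u - m' u"
        using assms(2) by (simp add: coprime_commute coprime_dvd_mult_right_iff)
      moreover have "\<bar>m u - m' u\<bar> < int Q"
        using PiE_mem[OF Y(1) u] PiE_mem[OF Y(2) u] by auto
      ultimately have "m u - m' u = 0" by (rule dvd_abs_less_imp_0)
      then show "m u = m' u" by simp
    qed
  qed
  moreover have "?f ` ?Y \<subseteq> ?Y" using assms(1) by auto
  ultimately show ?thesis
    unfolding bij_betw_def using endo_inj_surj[OF finite_PiE_interval] by blast
qed

text \<open>At a point within \<open>1/(6Q)\<close> to the right of \<open>a/Q\<close> the values \<open>a m\<^sub>u mod Q\<close> are independent and
  uniform, and averaging over the common shift \<open>m0\<close> replaces the oscillation between the points of
  the grid by one scalar factor.\<close>

lemma sum_norm_psum_ge: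
  assumes "Q > 0" "coprime a (int Q)" "0 \<le> t" "t * real Q \<le> 1 / 6"
  shows "real Q / 2 * norm (\<Sum>y\<in>PiE (nodes n) (\<lambda>_. {0..<int Q}).
      \<Sum>w | w \<in> nodes n \<and> inpos n w < inpos n (descent (\<lambda>u. half Q (y u)) n). tpacket \<theta> Q n w y)
    \<le> (\<Sum>m0\<in>{0..<int Q}. \<Sum>m\<in>PiE (nodes n) (\<lambda>_. {0..<int Q}).
        norm (psum \<theta> Q n m0 m (inpos n (descent (\<lambda>u. half Q (a * m u)) n)) (of_int a / of_nat Q + t)))"
proof -
  let ?Y = "PiE (nodes n) (\<lambda>_. {0..<int Q})" and ?x = "of_int a / of_nat Q + t"
  let ?T = "\<lambda>y. inpos n (descent (\<lambda>u. half Q (y u)) n)"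
  let ?s = "\<lambda>k m. \<Sum>u\<in>nodes n. k u * m u"
  define C where "C = (\<Sum>z\<in>{0..<int Q}. cis (2 * pi * Suc (nat z) * t))"
  have C: "real Q / 2 \<le> norm C" unfolding C_def by (rule norm_sum_cis_ge[OF assms(3,4)])
  \<comment> \<open>At \<open>a / Q\<close> only the residue of the frequency matters, so the
    reduction mod \<open>Q\<close> disappears and the part \<open>chr Q (a + a * m0)\<close>, whose
    first \<open>a\<close> stems from the \<open>Suc\<close> in \<open>freq\<close>, is unimodular
    and common to all terms. The offset \<open>t\<close> still sees the reduced frequency.\<close>
  have cis: "cis (2 * pi * freq Q n m0 m k * ?x)
      = chr Q (a + a * m0) * (chr Q (a * ?s k m) * cis (2 * pi * freq Q n m0 m k * t))" for m0 m k
  proof -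
    have "cis (2 * pi * freq Q n m0 m k * ?x)
        = chr Q (a * freq Q n m0 m k) * cis (2 * pi * freq Q n m0 m k * t)"
    proof -
      have "2 * pi * freq Q n m0 m k * ?x
          = 2 * pi * of_int (a * freq Q n m0 m k) / of_nat Q + 2 * pi * freq Q n m0 m k * t"
        by (simp add: distrib_left distrib_right mult_ac)
      then show ?thesis by (simp only: chr_def cis_mult)
    qed
    also have "chr Q (a * freq Q n m0 m k) = chr Q (a + a * ((m0 + ?s k m) mod int Q))"
      using assms(1) by (simp add: freq_def distrib_left)
    also have "\<dots> = chr Q (a + a * m0) * chr Q (a * ?s k m)"
      by (simp add: chr_add distrib_left)
    finally show ?thesis by (simp add: mult.assoc)
  qed
  define H where "H m m0 = (\<Sum>w | w \<in> nodes n \<and> inpos n w < ?T (\<lambda>u. a * m u). \<Sum>k\<in>large_coeffs \<theta> Q n w.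
      pcoeff Q n w k * chr Q (a * ?s k m) * cis (2 * pi * freq Q n m0 m k * t))" for m m0
  have "psum \<theta> Q n m0 m (?T (\<lambda>u. a * m u)) ?x = chr Q (a + a * m0) * H m m0" for m m0
    unfolding psum_def H_def cis sum_distrib_left by (simp add: mult_ac)
  then have psum: "norm (psum \<theta> Q n m0 m (?T (\<lambda>u. a * m u)) ?x) = norm (H m m0)" for m m0
    by (simp add: norm_mult)
  define V where "V m = (\<Sum>w | w \<in> nodes n \<and> inpos n w < ?T (\<lambda>u. a * m u). \<Sum>k\<in>large_coeffs \<theta> Q n w.
      pcoeff Q n w k * chr Q (a * ?s k m))" for m
  \<comment> \<open>For fixed \<open>m\<close> and \<open>k\<close> the residues
    \<open>m0 + ?s k m\<close> run through all of \<open>{0..<int Q}\<close> as \<open>m0\<close>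
    does, so every term acquires the same factor \<open>C\<close>.\<close>
  have "(\<Sum>m0\<in>{0..<int Q}. H m m0) = C * V m" for m
  proof -
    have shift: "(\<Sum>m0\<in>{0..<int Q}. cis (2 * pi * freq Q n m0 m k * t)) = C" for k
      unfolding C_def freq_def
      using sum_shift_mod[OF assms(1), of "\<lambda>z. cis (2 * pi * Suc (nat z) * t)" "?s k m"] .
    have "(\<Sum>m0\<in>{0..<int Q}. H m m0)
      = (\<Sum>w | w \<in> nodes n \<and> inpos n w < ?T (\<lambda>u. a * m u). \<Sum>m0\<in>{0..<int Q}. \<Sum>k\<in>large_coeffs \<theta> Q n w.
           pcoeff Q n w k * chr Q (a * ?s k m) * cis (2 * pi * freq Q n m0 m k * t))"
      unfolding H_def by (rule sum.swap)
    also have "\<dots> = (\<Sum>w | w \<in> nodes n \<and> inpos n w < ?T (\<lambda>u. a * m u). \<Sum>k\<in>large_coeffs \<theta> Q n w. \<Sum>m0\<in>{0..<int Q}.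
           pcoeff Q n w k * chr Q (a * ?s k m) * cis (2 * pi * freq Q n m0 m k * t))"
      by (intro sum.cong refl sum.swap)
    also have "\<dots> = (\<Sum>w | w \<in> nodes n \<and> inpos n w < ?T (\<lambda>u. a * m u). \<Sum>k\<in>large_coeffs \<theta> Q n w.
           pcoeff Q n w k * chr Q (a * ?s k m) * C)"
      by (simp only: sum_distrib_left[symmetric] shift)
    also have "\<dots> = V m * C" by (simp only: V_def sum_distrib_right)
    finally show ?thesis by (simp add: mult.commute)
  qed
  note H = this
  \<comment> \<open>\<open>V m\<close> is the right-turn sum at the point with coordinates
    \<open>a * m u mod Q\<close>, and these points run through all of \<open>?Y\<close> since
    \<open>a\<close> is invertible mod \<open>Q\<close>.\<close>
  have V: "V m = (\<Sum>w | w \<in> nodes n \<and> inpos n w < ?T (\<lambda>u\<in>nodes n. a * m u mod int Q).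
      tpacket \<theta> Q n w (\<lambda>u\<in>nodes n. a * m u mod int Q))" for m
  proof -
    have "descent (\<lambda>u. half Q (a * m u)) n = descent (\<lambda>u. half Q ((\<lambda>u\<in>nodes n. a * m u mod int Q) u)) n"
      by (rule descent_cong) simp
    moreover have "chr Q (a * ?s k m) = chr Q (?s k (\<lambda>u\<in>nodes n. a * m u mod int Q))" for k
      unfolding sum_distrib_left chr_sum by (intro prod.cong refl) (simp add: mult.left_commute)
    ultimately show ?thesis by (simp only: V_def tpacket_def)
  qed
  let ?V = "\<lambda>y. \<Sum>w | w \<in> nodes n \<and> inpos n w < ?T y. tpacket \<theta> Q n w y"
  have sum_V: "(\<Sum>m\<in>?Y. V m) = (\<Sum>y\<in>?Y. ?V y)"
    unfolding V using sum.reindex_bij_betw[OF bij_betw_mult_PiE[OF assms(1,2)], of ?V] .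
  have "real Q / 2 * norm (\<Sum>y\<in>?Y. ?V y) \<le> norm C * norm (\<Sum>m\<in>?Y. V m)"
    unfolding sum_V by (rule mult_right_mono[OF C norm_ge_zero])
  also have "\<dots> = norm (\<Sum>m\<in>?Y. \<Sum>m0\<in>{0..<int Q}. H m m0)"
    by (simp only: H norm_mult[symmetric] sum_distrib_left)
  also have "\<dots> \<le> (\<Sum>m\<in>?Y. \<Sum>m0\<in>{0..<int Q}. norm (H m m0))"
    by (intro order_trans[OF norm_sum sum_mono] norm_sum)
  also have "\<dots> = (\<Sum>m0\<in>{0..<int Q}. \<Sum>m\<in>?Y. norm (H m m0))"
    by (rule sum.swap)
  finally show ?thesis by (simp only: psum)
qed


section \<open>Maximal partial sums on the torus\<close>

lemma borel_measurable_torus [measurable (raw)]: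
  "f \<in> borel_measurable borel \<Longrightarrow> f \<in> borel_measurable torus"
  by (intro measurable_restrict_space1 measurable_completion) simp

lemma measure_torus: "{0..<1} \<inter> S \<in> sets lebesgue \<Longrightarrow> S \<subseteq> {0..<1} \<Longrightarrow> measure torus S = measure lebesgue S"
  by (subst measure_restrict_space) auto

lemma finite_measure_torus: "finite_measure torus"
  by (rule finite_measureI) (simp add: emeasure_restrict_space)

lemma measure_space_torus: "measure torus {0..<1} = 1"
  by (simp add: measure_restrict_space)

lemma integrable_torus_bounded:
  fixes f :: "real \<Rightarrow> 'a :: {banach, second_countable_topology}"
  assumes "f \<in> borel_measurable torus" "\<And>x. norm (f x) \<le> B"
  shows "integrable torus f"
  using finite_measure.integrable_const_bound[OF finite_measure_torus, of f B] assms by auto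

text \<open>The intervals of length \<open>1 / (6 * Q)\<close> to the right of \<open>a / Q\<close>
  for the \<open>Q / 2\<close> odd values of \<open>a\<close> are disjoint and have total measure
  \<open>1 / 12\<close>.\<close>

lemma integral_torus_ge:
  fixes g :: "real \<Rightarrow> real"
  assumes Q: "even Q" "Q > 0" and g: "integrable torus g" "\<And>x. 0 \<le> g x" and "\<kappa> \<ge> 0"
    and ge: "\<And>a t. a \<in> {0..<int Q} \<Longrightarrow> odd a \<Longrightarrow> 0 \<le> t \<Longrightarrow> t * real Q \<le> 1 / 6 \<Longrightarrow>
                \<kappa> \<le> g (of_int a / of_nat Q + t)"
  shows "\<kappa> / 12 \<le> (LINT x|torus. g x)"
proof -
  let ?A = "{a \<in> {0..<int Q}. odd a}"
  let ?J = "\<lambda>a. {of_int a / real Q..of_int a / real Q + 1 / (6 * real Q)}"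
  let ?h = "\<lambda>x. \<Sum>a\<in>?A. \<kappa> * indicator (?J a) x"
  have finA: "finite ?A" by (rule finite_subset[of _ "{0..<int Q}"]) auto
  obtain h where h: "Q = 2 * h" using Q(1) by (elim evenE)
  have "?A = (\<lambda>i. 2 * i + 1) ` {0..<int h}"
    by (auto simp: h elim!: oddE)
  then have cardA: "card ?A = h"
    by (simp add: card_image inj_on_def)
  have sub: "?J a \<subseteq> {0..<1}" if "a \<in> ?A" for a
  proof -
    have "of_int a + 1 \<le> real Q" using that by auto
    then have "(of_int a + 1) / real Q \<le> 1" using Q(2) by simp
    moreover have "of_int a / real Q + 1 / (6 * real Q) < (of_int a + 1) / real Q"
      using Q(2) by (simp add: field_simps)
    moreover have "0 \<le> of_int a / real Q" using that by simp
    ultimately show ?thesis by auto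
  qed
  have ind: "integrable torus (indicator (?J a) :: real \<Rightarrow> real)" for a
    by (rule integrable_torus_bounded[where B = 1]) (auto simp: indicator_def)
  have meas: "(LINT x|torus. indicator (?J a) x) = 1 / (6 * real Q)" if "a \<in> ?A" for a
  proof -
    have "(LINT x|torus. indicator (?J a) x) = measure torus (?J a)"
      using sub[OF that] by (simp add: Int_absorb2)
    also have "\<dots> = measure lebesgue (?J a)"
      using sub[OF that] by (intro measure_torus) auto
    also have "\<dots> = 1 / (6 * real Q)" by simp
    finally show ?thesis .
  qed
  have "?h x \<le> g x" for x
  proof (cases "\<exists>a\<in>?A. x \<in> ?J a")
    case True
    then obtain a where a: "a \<in> ?A" "x \<in> ?J a" by blast
    have "x \<notin> ?J b" if b: "b \<in> ?A" "b \<noteq> a" for b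
    proof
      assume x: "x \<in> ?J b"
      have *: "c \<le> d" if "x \<in> ?J c" "x \<in> ?J d" for c d
      proof -
        have "of_int c / real Q \<le> of_int d / real Q + 1 / (6 * real Q)"
          using that by auto
        then have "of_int c \<le> of_int d + (1 / 6 :: real)" using Q(2) by (simp add: field_simps)
        then show ?thesis by linarith
      qed
      show False using *[OF x a(2)] *[OF a(2) x] b(2) by simp
    qed
    then have "?h x = (\<Sum>b\<in>?A. if b = a then \<kappa> else 0)"
      using a by (intro sum.cong) (auto simp: indicator_def)
    also have "\<dots> = \<kappa>" using finA a by simp
    also have "\<kappa> \<le> g (of_int a / of_nat Q + (x - of_int a / of_nat Q))"
    proof (rule ge)
      have "x - of_int a / of_nat Q \<le> 1 / (6 * real Q)" using a(2) by auto
      then have "(x - of_int a / of_nat Q) * real Q \<le> 1 / (6 * real Q) * real Q"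
        by (intro mult_right_mono) auto
      then show "(x - of_int a / of_nat Q) * real Q \<le> 1 / 6" using Q(2) by simp
    qed (use a in auto)
    finally show ?thesis by simp
  next
    case False
    then have "?h x = 0" by (intro sum.neutral) (auto simp: indicator_def)
    then show ?thesis using g(2) by simp
  qed
  then have "(LINT x|torus. ?h x) \<le> (LINT x|torus. g x)"
    using ind by (intro integral_mono g Bochner_Integration.integrable_sum integrable_mult_right) auto
  also have "(LINT x|torus. ?h x) = (\<Sum>a\<in>?A. \<kappa> * (1 / (6 * real Q)))"
    using ind meas by (subst Bochner_Integration.integral_sum) (auto intro!: sum.cong integrable_mult_right)
  also have "\<dots> = \<kappa> / 12" using Q(2) by (simp only: sum_constant cardA) (simp add: h)
  finally show ?thesis .
qed

subsection \<open>From the weak norm to the integral\<close>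

text \<open>If \<open>y\<close> exceeds \<open>A\<close>, then the last dyadic level below
  \<open>y\<close> already contributes twice its height, which is at least \<open>y\<close>.\<close>

lemma dyadic_layer_bound:
  fixes y A :: real
  assumes "y \<le> 2 ^ L * A" "A > 0"
  shows "y \<le> A + (\<Sum>i<L. 2 ^ Suc i * A * indicator {z. 2 ^ i * A < z} y)"
  using assms(1)
proof (induction L)
  case (Suc L)
  have nonneg: "0 \<le> (\<Sum>i<L. 2 ^ Suc i * A * indicator {z. 2 ^ i * A < z} y)"
    using assms(2) by (intro sum_nonneg) auto
  show ?case
  proof (cases "y \<le> 2 ^ L * A")
    case True
    then show ?thesis using Suc.IH assms(2) by (auto simp: indicator_def)
  next
    case False
    then have "y \<le> 2 ^ Suc L * A * indicator {z. 2 ^ L * A < z} y" using Suc.prems by simp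
    then show ?thesis using nonneg assms(2) by simp
  qed
qed simp

text \<open>The weak bound at level \<open>2 ^ i * A\<close> gives measure at most \<open>4\<close>
  to the power \<open>- i\<close>. Summing the dyadic layers yields \<open>A\<close> plus a
  geometric series of sum at most \<open>4 * A\<close>. The bound \<open>M\<close> makes the number
  of layers finite.\<close>

lemma integral_le_weak_bound:
  fixes g :: "real \<Rightarrow> real"
  assumes g: "g \<in> borel_measurable torus" "\<And>x. 0 \<le> g x" "\<And>x. g x \<le> M" and "A > 0"
    and weak: "\<And>l. l > 0 \<Longrightarrow> l * sqrt (measure torus {x \<in> space torus. g x > l}) \<le> A"
  shows "(LINT x|torus. g x) \<le> 5 * A"
proof -
  obtain L where L: "M / A < 2 ^ L"
    using real_arch_pow[of 2 "M / A"] by auto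
  then have Mle: "M \<le> 2 ^ L * A" using assms(4) by (simp add: field_simps)
  let ?S = "\<lambda>i. {x \<in> space torus. g x > 2 ^ i * A}"
  have S[measurable]: "?S i \<in> sets torus" for i using g(1) by measurable
  have Sm: "2 ^ Suc i * A * measure torus (?S i) \<le> 2 * A * (1 / 2) ^ i" for i
  proof -
    have "(2 ^ i * A * sqrt (measure torus (?S i)))\<^sup>2 \<le> A\<^sup>2"
      using assms(4) by (intro power_mono weak) auto
    then have "(2 ^ i * A)\<^sup>2 * measure torus (?S i) \<le> A\<^sup>2"
      by (simp add: power_mult_distrib)
    then have "A * (2 ^ i * A * (2 ^ i * measure torus (?S i))) \<le> A * A"
      by (simp add: power2_eq_square mult_ac)
    then have "2 ^ i * A * (2 ^ i * measure torus (?S i)) \<le> A"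
      using assms(4) by simp
    then show ?thesis by (simp add: power_divide field_simps)
  qed
  have int: "integrable torus (indicator (?S i) :: real \<Rightarrow> real)" for i
    by (rule integrable_torus_bounded[where B = 1]) (auto simp: indicator_def)
  have "(LINT x|torus. g x) \<le> (LINT x|torus. A + (\<Sum>i<L. 2 ^ Suc i * A * indicator (?S i) x))"
  proof (rule integral_mono)
    show "integrable torus g"
      using g by (intro integrable_torus_bounded[where B = M]) auto
    show "integrable torus (\<lambda>x. A + (\<Sum>i<L. 2 ^ Suc i * A * indicator (?S i) x))"
      using int finite_measure.integrable_const[OF finite_measure_torus]
      by (intro Bochner_Integration.integrable_add Bochner_Integration.integrable_sum integrable_mult_right) auto
    fix x assume "x \<in> space torus"
    then show "g x \<le> A + (\<Sum>i<L. 2 ^ Suc i * A * indicator (?S i) x)"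
      using dyadic_layer_bound[OF order_trans[OF g(3) Mle] assms(4), of x]
      by (simp add: indicator_def)
  qed
  also have "\<dots> = A + (\<Sum>i<L. 2 ^ Suc i * A * measure torus (?S i))"
  proof -
    have "(LINT x|torus. indicator (?S i) x) = measure torus (?S i)" for i
      by (simp, rule arg_cong[of _ _ "measure torus"], auto)
    then have ms: "(LINT x|torus. 2 ^ Suc i * A * indicator (?S i) x) = 2 ^ Suc i * A * measure torus (?S i)" for i
      by (simp only: integral_mult_right_zero)
    have si: "integrable torus (\<lambda>x. 2 ^ Suc i * A * indicator (?S i) x)" for i
      by (intro integrable_mult_right int)
    have "(LINT x|torus. A + (\<Sum>i<L. 2 ^ Suc i * A * indicator (?S i) x))
        = (LINT x|torus. A) + (LINT x|torus. (\<Sum>i<L. 2 ^ Suc i * A * indicator (?S i) x))"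
      by (intro Bochner_Integration.integral_add Bochner_Integration.integrable_sum si
          finite_measure.integrable_const[OF finite_measure_torus])
    also have "(LINT x|torus. (\<Sum>i<L. 2 ^ Suc i * A * indicator (?S i) x))
        = (\<Sum>i<L. (LINT x|torus. 2 ^ Suc i * A * indicator (?S i) x))"
      by (intro Bochner_Integration.integral_sum si)
    also have "(LINT x|torus. A) = A" by (simp add: measure_space_torus)
    finally show ?thesis by (simp only: ms)
  qed
  also have "\<dots> \<le> A + (\<Sum>i<L. 2 * A * (1 / 2) ^ i)"
    by (intro add_left_mono sum_mono Sm)
  also have "\<dots> \<le> 5 * A"
  proof -
    have "(\<Sum>i<L. (1 / 2 :: real) ^ i) \<le> 2"
      by (simp add: sum_gp_strict)
    then have "2 * A * (\<Sum>i<L. (1 / 2 :: real) ^ i) \<le> 2 * A * 2"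
      using assms(4) by (intro mult_left_mono) auto
    then show ?thesis by (simp add: sum_distrib_left)
  qed
  finally show ?thesis .
qed

lemma weak_L2_norm_ge:
  assumes f: "f \<in> L2_torus" "L2_norm f \<le> 1"
    and g: "T f \<in> borel_measurable torus" "\<And>x. 0 \<le> T f x" "\<And>x. T f x \<le> M"
    and A: "A > 0" "5 * A \<le> (LINT x|torus. T f x)"
  shows "ennreal A \<le> weak_L2_norm T"
proof (rule ccontr)
  assume "\<not> ennreal A \<le> weak_L2_norm T"
  then have less: "weak_L2_norm T < ennreal A" by simp
  define B where "B = enn2real (weak_L2_norm T)"
  have B: "weak_L2_norm T = ennreal B" "0 \<le> B"
    using less by (auto simp: B_def less_top[symmetric] dest: order_less_le_trans[OF _ ennreal_less_top[THEN less_imp_le]])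
  then have "B < A" using less A(1) by (simp add: ennreal_less_iff)
  \<comment> \<open>The midpoint of \<open>A\<close> and \<open>B\<close> is used because it stays
    below \<open>A\<close> and is positive even if \<open>B\<close> is 0, as
    \<open>integral_le_weak_bound\<close> demands.\<close>
  have "l * sqrt (measure torus {x \<in> space torus. T f x > l}) \<le> (A + B) / 2" if "l > 0" for l
  proof -
    have "ennreal (l * sqrt (measure torus {x \<in> space torus. \<bar>T f x\<bar> > l})) \<le> weak_L2_norm T"
      unfolding weak_L2_norm_def
      by (rule SUP_upper2[of "(f, l)"]) (use f that in auto)
    then have "l * sqrt (measure torus {x \<in> space torus. \<bar>T f x\<bar> > l}) \<le> B"
      unfolding B(1) using B(2) by (simp add: ennreal_le_iff)
    then show ?thesis using \<open>B < A\<close> g(2) by (simp add: abs_of_nonneg)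
  qed
  then have "(LINT x|torus. T f x) \<le> 5 * ((A + B) / 2)"
    using A(1) B(2) by (intro integral_le_weak_bound[OF g]) auto
  moreover have "5 * ((A + B) / 2) < 5 * A" using \<open>B < A\<close> by simp
  ultimately show False using A(2) by simp
qed


subsection \<open>Trigonometric polynomials\<close>

text \<open>For \<open>d \<noteq> 0\<close> the antiderivative has period 1. The fundamental theorem
  is applied on the closed interval, which differs from the torus by a null set.\<close>

lemma integral_cis_torus:
  "(LINT x|torus. cis (2 * pi * of_int d * x)) = (if d = 0 then 1 else 0)"
proof (cases "d = 0")
  case True
  then show ?thesis by (simp add: measure_space_torus)
next
  case False
  let ?f = "\<lambda>x. cis (2 * pi * of_int d * x)"
  let ?F = "\<lambda>x. cis (2 * pi * of_int d * x) / (2 * pi * of_int d * \<i>)"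
  have "(?f has_integral (?F 1 - ?F 0)) {0..1}"
  proof (rule fundamental_theorem_of_calculus)
    fix x :: real assume "x \<in> {0..1}"
    have "((\<lambda>x. exp (\<i> * of_real (2 * pi * of_int d * x)) / (2 * pi * of_int d * \<i>)) has_vector_derivative
        exp (\<i> * of_real (2 * pi * of_int d * x))) (at x within {0..1})"
      using False by (auto intro!: derivative_eq_intros has_vector_derivative_real_field simp: field_simps)
    then show "(?F has_vector_derivative ?f x) (at x within {0..1})"
      by (simp add: cis_conv_exp)
  qed simp
  moreover have "?F 1 = ?F 0"
    using cis_multiple_2pi[of "of_int d"] by simp
  ultimately have "(?f has_integral 0) {0..1}" by simp
  moreover have "(?f has_integral 0) {0..1} \<longleftrightarrow> (?f has_integral 0) {0..<1}"
    by (rule has_integral_spike_set_eq; rule negligible_subset[of "{1}"]) auto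
  ultimately have "(?f has_integral 0) {0..<1}" by blast
  then have "integral {0..<1} ?f = 0" by (rule integral_unique)
  moreover have "integrable torus ?f"
    by (rule integrable_torus_bounded[where B = 1])
       (auto intro!: borel_measurable_torus borel_measurable_continuous_onI continuous_intros)
  ultimately show ?thesis
    using False by (subst lebesgue_integral_eq_integral) auto
qed

definition tpoly :: "'i set \<Rightarrow> ('i \<Rightarrow> complex) \<Rightarrow> ('i \<Rightarrow> nat) \<Rightarrow> real \<Rightarrow> complex" where
  "tpoly I b r x = (\<Sum>i\<in>I. b i * cis (2 * pi * of_nat (r i) * x))"

lemma continuous_tpoly: "continuous_on S (tpoly I b r)"
  unfolding tpoly_def by (intro continuous_intros)

lemma norm_tpoly_le: "norm (tpoly I b r x) \<le> (\<Sum>i\<in>I. norm (b i))"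
  unfolding tpoly_def by (rule order_trans[OF norm_sum]) (simp add: norm_mult)

lemma integrable_cis_torus: "integrable torus (\<lambda>x. c * cis (2 * pi * of_int d * x))"
  by (rule integrable_torus_bounded[where B = "norm c"])
     (auto simp: norm_mult intro!: borel_measurable_torus borel_measurable_continuous_onI continuous_intros)

lemma fourier_coeff_tpoly:
  assumes "finite I"
  shows "fourier_coeff (tpoly I b r) (int j) = (\<Sum>i\<in>I. if r i = j then b i else 0)"
proof -
  have "exp (- 2 * of_real pi * \<i> * of_int (int j) * of_real x) = cis (2 * pi * of_int (- int j) * x)" for x
    by (simp add: cis_conv_exp mult_ac)
  then have "fourier_coeff (tpoly I b r) (int j)
      = (LINT x|torus. (\<Sum>i\<in>I. b i * cis (2 * pi * of_int (int (r i) - int j) * x)))"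
    unfolding fourier_coeff_def tpoly_def sum_distrib_right
    by (simp add: mult.assoc cis_mult algebra_simps)
  also have "\<dots> = (\<Sum>i\<in>I. (LINT x|torus. b i * cis (2 * pi * of_int (int (r i) - int j) * x)))"
    by (intro Bochner_Integration.integral_sum integrable_cis_torus)
  also have "\<dots> = (\<Sum>i\<in>I. b i * (LINT x|torus. cis (2 * pi * of_int (int (r i) - int j) * x)))"
    by (intro sum.cong refl integral_mult_right) (use integrable_cis_torus[of 1] in simp)
  also have "\<dots> = (\<Sum>i\<in>I. if r i = j then b i else 0)"
    by (intro sum.cong refl) (simp only: integral_cis_torus, simp)
  finally show ?thesis .
qed

lemma tpoly_L2:
  assumes "finite I" "inj_on r I"
  shows "tpoly I b r \<in> L2_torus" "L2_norm (tpoly I b r) = sqrt (\<Sum>i\<in>I. (norm (b i))\<^sup>2)"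
proof -
  let ?f = "tpoly I b r"
  have meas: "?f \<in> borel_measurable torus"
    by (intro borel_measurable_torus borel_measurable_continuous_onI continuous_tpoly)
  have int: "integrable torus (\<lambda>x. (norm (?f x))\<^sup>2)"
  proof (rule integrable_torus_bounded)
    show "(\<lambda>x. (norm (?f x))\<^sup>2) \<in> borel_measurable torus" using meas by measurable
    show "norm ((norm (?f x))\<^sup>2) \<le> (\<Sum>i\<in>I. norm (b i))\<^sup>2" for x
      by (simp add: power_mono norm_tpoly_le)
  qed
  show "?f \<in> L2_torus" using meas int unfolding L2_torus_def by blast
  have "of_real (LINT x|torus. (norm (?f x))\<^sup>2) = (LINT x|torus. of_real ((norm (?f x))\<^sup>2) :: complex)"
    by (rule integral_of_real[symmetric]) (rule int)
  also have "\<dots> = (LINT x|torus. (\<Sum>i\<in>I. \<Sum>j\<in>I. (b i * cnj (b j)) * cis (2 * pi * of_int (int (r i) - int (r j)) * x)))"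
    unfolding complex_norm_square tpoly_def cnj_sum sum_product
    by (intro Bochner_Integration.integral_cong refl sum.cong) (simp add: cis_cnj cis_mult algebra_simps)
  also have "\<dots> = (\<Sum>i\<in>I. \<Sum>j\<in>I. (LINT x|torus. (b i * cnj (b j)) * cis (2 * pi * of_int (int (r i) - int (r j)) * x)))"
    by (simp only: Bochner_Integration.integral_sum Bochner_Integration.integrable_sum integrable_cis_torus)
  also have "\<dots> = (\<Sum>i\<in>I. \<Sum>j\<in>I. (b i * cnj (b j)) * (LINT x|torus. cis (2 * pi * of_int (int (r i) - int (r j)) * x)))"
    by (intro sum.cong refl integral_mult_right) (use integrable_cis_torus[of 1] in simp)
  also have "\<dots> = (\<Sum>i\<in>I. \<Sum>j\<in>I. if j = i then b i * cnj (b i) else 0)"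
    using assms(2) by (intro sum.cong refl) (simp only: integral_cis_torus, auto simp: inj_on_def)
  also have "\<dots> = of_real (\<Sum>i\<in>I. (norm (b i))\<^sup>2)"
    using assms(1) by (simp add: complex_norm_square[symmetric])
  finally show "L2_norm ?f = sqrt (\<Sum>i\<in>I. (norm (b i))\<^sup>2)"
    unfolding L2_norm_def by (simp only: of_real_eq_iff)
qed

lemma max_partial_sum_nonneg:
  assumes "N \<ge> 1"
  shows "0 \<le> max_partial_sum \<sigma> N f x"
proof -
  let ?S = "(\<lambda>m. norm (\<Sum>k=1..m. fourier_coeff f (int (\<sigma> k)) *
                  exp (2 * of_real pi * \<i> * of_nat (\<sigma> k) * of_real x))) ` {1..N}"
  have "norm (\<Sum>k=1..1. fourier_coeff f (int (\<sigma> k)) *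
                  exp (2 * of_real pi * \<i> * of_nat (\<sigma> k) * of_real x)) \<le> Max ?S"
    using assms by (intro Max_ge image_eqI[where x = 1]) simp_all
  then show ?thesis unfolding max_partial_sum_def by (rule order_trans[OF norm_ge_zero])
qed

lemma max_partial_sum_bounded:
  assumes "N \<ge> 1"
  shows "max_partial_sum \<sigma> N f x \<le> (\<Sum>k=1..N. norm (fourier_coeff f (int (\<sigma> k))))"
  unfolding max_partial_sum_def
proof (rule Max.boundedI)
  fix y assume "y \<in> (\<lambda>m. norm (\<Sum>k=1..m. fourier_coeff f (int (\<sigma> k)) *
                  exp (2 * of_real pi * \<i> * of_nat (\<sigma> k) * of_real x))) ` {1..N}"
  then obtain m where m: "m \<in> {1..N}" "y = norm (\<Sum>k=1..m. fourier_coeff f (int (\<sigma> k)) *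
                  exp (2 * of_real pi * \<i> * of_nat (\<sigma> k) * of_real x))" by blast
  have "norm (exp (2 * of_real pi * \<i> * of_nat j * of_real x)) = 1" for j
    by simp
  then have "y \<le> (\<Sum>k=1..m. norm (fourier_coeff f (int (\<sigma> k))))"
    unfolding m(2) by (intro order_trans[OF norm_sum]) (simp add: norm_mult)
  also have "\<dots> \<le> (\<Sum>k=1..N. norm (fourier_coeff f (int (\<sigma> k))))"
    using m(1) by (intro sum_mono2) auto
  finally show "y \<le> (\<Sum>k=1..N. norm (fourier_coeff f (int (\<sigma> k))))" .
qed (use assms in auto)

lemma max_partial_sum_measurable:
  assumes "N \<ge> 1"
  shows "max_partial_sum \<sigma> N f \<in> borel_measurable torus"
proof -
  have "(\<lambda>x. Max ((\<lambda>m. norm (\<Sum>k=1..m. fourier_coeff f (int (\<sigma> k)) *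
                  exp (2 * of_real pi * \<i> * of_nat (\<sigma> k) * of_real x))) ` {1..N})) \<in> borel_measurable torus"
    by (intro borel_measurable_Max borel_measurable_torus borel_measurable_continuous_onI continuous_intros) auto
  then show ?thesis by (simp add: max_partial_sum_def[abs_def])
qed

section \<open>Rearranging the spectrum into blocks\<close>

lemma permutation_sorting:
  fixes kf :: "nat \<Rightarrow> nat"
  obtains \<sigma> where "\<sigma> permutes {1..N}"
    "\<And>i j. 1 \<le> i \<Longrightarrow> i \<le> j \<Longrightarrow> j \<le> N \<Longrightarrow> kf (\<sigma> i) \<le> kf (\<sigma> j)"
proof -
  define L where "L = sort_key kf [1..<Suc N]"
  have L: "length L = N" "distinct L" "set L = {1..N}" "sorted (map kf L)"
    by (auto simp: L_def simp del: upt_Suc)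
  define \<sigma> where "\<sigma> k = (if k \<in> {1..N} then L ! (k - 1) else k)" for k
  have "bij_betw (\<lambda>k. k - 1) {1..N} {..<N}"
    by (rule bij_betw_byWitness[where f' = Suc]) auto
  moreover have "bij_betw ((!) L) {..<N} {1..N}"
    using bij_betw_nth[OF L(2), of "{..<N}" "{1..N}"] L by simp
  ultimately have "bij_betw ((!) L \<circ> (\<lambda>k. k - 1)) {1..N} {1..N}"
    by (rule bij_betw_trans)
  moreover have "bij_betw \<sigma> {1..N} {1..N} = bij_betw ((!) L \<circ> (\<lambda>k. k - 1)) {1..N} {1..N}"
    by (rule bij_betw_cong) (simp add: \<sigma>_def)
  ultimately have "\<sigma> permutes {1..N}"
    by (intro bij_imp_permutes) (auto simp: \<sigma>_def)
  moreover have "kf (\<sigma> i) \<le> kf (\<sigma> j)" if "1 \<le> i" "i \<le> j" "j \<le> N" for i j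
    using sorted_nth_mono[OF L(4), of "i - 1" "j - 1"] that L(1) by (simp add: \<sigma>_def)
  ultimately show ?thesis by (rule that)
qed

text \<open>The permutation sorts the frequencies by the key of their block. Every sum over the
  blocks with key below \<open>T\<close> is then an initial partial sum of the rearranged series,
  with one permutation serving all \<open>T\<close> and \<open>x\<close>.\<close>

lemma tpoly_blocks_le_max_partial_sum:
  assumes "finite I" "inj_on r I" "r ` I \<subseteq> {1..N}" "N \<ge> 1"
  obtains \<sigma> where "\<sigma> permutes {1..N}"
    "\<And>T x. norm (tpoly {i \<in> I. key i < (T::nat)} b r x) \<le> max_partial_sum \<sigma> N (tpoly I b r) x"
proof -
  \<comment> \<open>Frequencies outside the spectrum receive the key 0; their coefficients vanish,
    so their place in the order does not affect any sum.\<close>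
  define kf where "kf j = (if j \<in> r ` I then key (the_inv_into I r j) else 0)" for j
  have kf: "kf (r i) = key i" if "i \<in> I" for i
    using that assms(2) by (simp add: kf_def the_inv_into_f_f)
  obtain \<sigma> where \<sigma>: "\<sigma> permutes {1..N}"
    and mono: "\<And>i j. 1 \<le> i \<Longrightarrow> i \<le> j \<Longrightarrow> j \<le> N \<Longrightarrow> kf (\<sigma> i) \<le> kf (\<sigma> j)"
    using permutation_sorting[of N kf] by blast
  let ?c = "\<lambda>j. fourier_coeff (tpoly I b r) (int j)"
  let ?e = "\<lambda>j x. exp (2 * of_real pi * \<i> * of_nat j * of_real x)"
  have c: "?c (r i) = b i" if "i \<in> I" for i
  proof -
    have "?c (r i) = (\<Sum>i'\<in>I. if i' = i then b i' else 0)"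
      unfolding fourier_coeff_tpoly[OF assms(1)] using that assms(2)
      by (intro sum.cong) (auto simp: inj_on_def)
    then show ?thesis using that assms(1) by simp
  qed
  have c0: "?c j = 0" if "j \<notin> r ` I" for j
    unfolding fourier_coeff_tpoly[OF assms(1)] using that by (intro sum.neutral) auto
  have "norm (tpoly {i \<in> I. key i < T} b r x) \<le> max_partial_sum \<sigma> N (tpoly I b r) x" for T x
  proof -
    let ?P = "{k \<in> {1..N}. kf (\<sigma> k) < T}"
    have "tpoly {i \<in> I. key i < T} b r x = (\<Sum>i | i \<in> I \<and> key i < T. ?c (r i) * ?e (r i) x)"
      by (subst tpoly_def) (intro sum.cong, simp_all add: c cis_conv_exp mult_ac)
    also have "\<dots> = (\<Sum>j\<in>r ` {i \<in> I. key i < T}. ?c j * ?e j x)"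
      by (subst sum.reindex[OF inj_on_subset[OF assms(2)]]) auto
    also have "\<dots> = (\<Sum>j | j \<in> {1..N} \<and> kf j < T. ?c j * ?e j x)"
    proof (rule sum.mono_neutral_left)
      show "r ` {i \<in> I. key i < T} \<subseteq> {j \<in> {1..N}. kf j < T}"
        using assms(3) kf by auto
      show "\<forall>j\<in>{j \<in> {1..N}. kf j < T} - r ` {i \<in> I. key i < T}. ?c j * ?e j x = 0"
        using c0 kf by force
    qed simp
    also have "{j \<in> {1..N}. kf j < T} = \<sigma> ` ?P"
    proof -
      have "j \<in> \<sigma> ` ?P" if "j \<in> {1..N}" "kf j < T" for j
      proof -
        obtain k where "k \<in> {1..N}" "j = \<sigma> k"
          using permutes_image[OF \<sigma>] \<open>j \<in> {1..N}\<close> by blast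
        then show ?thesis using that by auto
      qed
      then show ?thesis using permutes_in_image[OF \<sigma>] by auto
    qed
    also have "(\<Sum>j\<in>\<sigma> ` ?P. ?c j * ?e j x) = (\<Sum>k\<in>?P. ?c (\<sigma> k) * ?e (\<sigma> k) x)"
      by (subst sum.reindex[OF inj_on_subset[OF permutes_inj_on[OF \<sigma>, of UNIV]]]) auto
    finally have eq: "tpoly {i \<in> I. key i < T} b r x = (\<Sum>k\<in>?P. ?c (\<sigma> k) * ?e (\<sigma> k) x)" .
    show ?thesis
    \<comment> \<open>The maximal function starts at \<open>m = 1\<close>, so the empty partial sum
      is treated separately. Otherwise monotonicity of the keys makes \<open>?P\<close> an initial
      segment.\<close>
    proof (cases "?P = {}")
      case True
      show ?thesis unfolding eq True sum.empty norm_zero by (rule max_partial_sum_nonneg[OF assms(4)])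
    next
      case False
      define m where "m = Max ?P"
      have "m \<in> ?P" unfolding m_def using False by (intro Max_in) auto
      have P: "?P = {1..m}"
      proof (intro equalityI subsetI)
        fix k assume "k \<in> ?P"
        then show "k \<in> {1..m}" unfolding m_def by auto
      next
        fix k assume "k \<in> {1..m}"
        then show "k \<in> ?P" using \<open>m \<in> ?P\<close> mono[of k m] by auto
      qed
      show ?thesis unfolding eq P max_partial_sum_def
        using \<open>m \<in> ?P\<close> by (intro Max_ge) auto
    qed
  qed
  with \<sigma> show ?thesis by (rule that)
qed


text \<open>The cut \<open>T\<close> may depend on the point, so \<open>g\<close> can be a maximal
  function over blocks. Its integral is a lower bound for that of the rearranged maximal function,
  to which the comparison with weak \<open>L\<^sup>2\<close> applies.\<close>

lemma weak_L2_norm_rearranged_ge: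
  fixes key :: "'i \<Rightarrow> nat"
  assumes I: "finite I" "inj_on r I" "r ` I \<subseteq> {1..N}" "N \<ge> 1"
    and b: "(\<Sum>i\<in>I. (norm (b i))\<^sup>2) \<le> 1"
    and g: "integrable torus g" "\<And>x. \<exists>T. g x \<le> norm (tpoly {i \<in> I. key i < T} b r x)"
    and A: "A > 0" "5 * A \<le> (LINT x|torus. g x)"
  shows "\<exists>\<sigma>. \<sigma> permutes {1..N} \<and> weak_L2_norm (max_partial_sum \<sigma> N) \<ge> ennreal A"
proof -
  obtain \<sigma> where \<sigma>: "\<sigma> permutes {1..N}"
    and le: "\<And>T x. norm (tpoly {i \<in> I. key i < T} b r x) \<le> max_partial_sum \<sigma> N (tpoly I b r) x"
    using tpoly_blocks_le_max_partial_sum[OF I, of key b] by blast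
  let ?M = "max_partial_sum \<sigma> N (tpoly I b r)"
  note bounds = max_partial_sum_nonneg[OF I(4)] max_partial_sum_bounded[OF I(4)]
    max_partial_sum_measurable[OF I(4)]
  have int: "integrable torus ?M"
    using bounds by (intro integrable_torus_bounded) auto
  have "(LINT x|torus. g x) \<le> (LINT x|torus. ?M x)"
  proof (rule integral_mono[OF g(1) int])
    fix x obtain T where "g x \<le> norm (tpoly {i \<in> I. key i < T} b r x)" using g(2) by blast
    then show "g x \<le> ?M x" using le order_trans by blast
  qed
  then have "5 * A \<le> (LINT x|torus. ?M x)" using A(2) by simp
  then have "ennreal A \<le> weak_L2_norm (max_partial_sum \<sigma> N)"
    using b by (intro weak_L2_norm_ge[OF tpoly_L2(1)[OF I(1,2)] _ bounds(3,1,2) A(1)])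
      (simp_all add: tpoly_L2(2)[OF I(1,2)])
  with \<sigma> show ?thesis by blast
qed

section \<open>Choosing the frequencies\<close>

text \<open>The range of \<open>T\<close> contains all in-order positions, so the cut at any leaf is
  included.\<close>

definition maxsum :: "real \<Rightarrow> nat \<Rightarrow> nat \<Rightarrow> int \<Rightarrow> (bool list \<Rightarrow> int) \<Rightarrow> real \<Rightarrow> real" where
  "maxsum \<theta> Q n m0 m x = Max ((\<lambda>T. norm (psum \<theta> Q n m0 m T x)) ` {..2 ^ Suc n})"

lemma norm_psum_le_maxsum: "T \<le> 2 ^ Suc n \<Longrightarrow> norm (psum \<theta> Q n m0 m T x) \<le> maxsum \<theta> Q n m0 m x"
  unfolding maxsum_def by (intro Max_ge) auto

lemma maxsum_attained: "\<exists>T. maxsum \<theta> Q n m0 m x = norm (psum \<theta> Q n m0 m T x)"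
proof -
  have "maxsum \<theta> Q n m0 m x \<in> (\<lambda>T. norm (psum \<theta> Q n m0 m T x)) ` {..2 ^ Suc n}"
    unfolding maxsum_def by (rule Max_in) auto
  then show ?thesis by blast
qed

lemma psum_eq_tpoly:
  "psum \<theta> Q n m0 m T x
     = tpoly {i \<in> packet_index \<theta> Q n. inpos n (fst i) < T} (\<lambda>i. pcoeff Q n (fst i) (snd i)) (\<lambda>i. freq Q n m0 m (snd i)) x"
proof -
  have "{i \<in> packet_index \<theta> Q n. inpos n (fst i) < T} = Sigma {w. w \<in> nodes n \<and> inpos n w < T} (large_coeffs \<theta> Q n)"
    by (auto simp: packet_index_def)
  then show ?thesis
    unfolding psum_def tpoly_def by (simp add: sum.Sigma split_beta)
qed

lemma norm_psum_le_card: "norm (psum \<theta> Q n m0 m T x) \<le> card (packet_index \<theta> Q n)"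
proof -
  have "norm (psum \<theta> Q n m0 m T x)
      \<le> (\<Sum>i | i \<in> packet_index \<theta> Q n \<and> inpos n (fst i) < T. norm (pcoeff Q n (fst i) (snd i)))"
    unfolding psum_eq_tpoly by (rule norm_tpoly_le)
  also have "\<dots> \<le> (\<Sum>i | i \<in> packet_index \<theta> Q n \<and> inpos n (fst i) < T. 1)"
    by (intro sum_mono norm_pcoeff_le_1)
  also have "\<dots> \<le> (\<Sum>i\<in>packet_index \<theta> Q n. 1)"
    by (intro sum_mono2) auto
  finally show ?thesis by simp
qed

lemma maxsum_bounds: "0 \<le> maxsum \<theta> Q n m0 m x" "maxsum \<theta> Q n m0 m x \<le> card (packet_index \<theta> Q n)"
  using maxsum_attained[of \<theta> Q n m0 m x] norm_psum_le_card by (metis norm_ge_zero)+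

lemma integrable_maxsum: "integrable torus (maxsum \<theta> Q n m0 m)"
proof (rule integrable_torus_bounded)
  have "(\<lambda>x. norm (psum \<theta> Q n m0 m T x)) \<in> borel_measurable torus" for T
    unfolding psum_eq_tpoly
    by (intro borel_measurable_torus borel_measurable_continuous_onI continuous_on_norm continuous_tpoly)
  then have "(\<lambda>x. Max ((\<lambda>T. norm (psum \<theta> Q n m0 m T x)) ` {..2 ^ Suc n})) \<in> borel_measurable torus"
    by (intro borel_measurable_Max) auto
  then show "maxsum \<theta> Q n m0 m \<in> borel_measurable torus"
    by (simp only: maxsum_def[abs_def])
  show "norm (maxsum \<theta> Q n m0 m x) \<le> card (packet_index \<theta> Q n)" for x
    using maxsum_bounds[of \<theta> Q n m0 m x] by simp
qed

lemma exists_ge_average: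
  fixes v :: "'a \<Rightarrow> real"
  assumes "finite G" "real (card G) \<le> C" "C > 0" "c > 0" "C * c \<le> sum v G"
  shows "\<exists>i\<in>G. c \<le> v i"
proof (rule ccontr)
  assume *: "\<not> (\<exists>i\<in>G. c \<le> v i)"
  show False
  proof (cases "G = {}")
    case True
    then have "C * c \<le> 0" using assms(5) by simp
    then show False using mult_pos_pos[OF assms(3,4)] by linarith
  next
    case False
    then have "sum v G < (\<Sum>i\<in>G. c)"
      using * assms(1) by (intro sum_strict_mono) auto
    also have "\<dots> \<le> C * c" using assms(2,4) by (simp add: mult_right_mono)
    finally show False using assms(5) by simp
  qed
qed

text \<open>Summed over all pairs \<open>(m0, m)\<close>, the maximal function near
  \<open>a / Q\<close> with \<open>a\<close> odd is at least \<open>D * Q * n / 8\<close>. The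
  colliding pairs take away at most half of this: the maximal function is at most the number of
  indices, and the collision bound contributes its square, whence the cube in \<open>few\<close>.
  Integration costs the factor 12, and some pair without collision reaches the average
  \<open>n / 192\<close>.\<close>

lemma exists_good_frequencies:
  assumes Q: "even Q" "Q > 0" "\<And>a. odd a \<Longrightarrow> coprime a (int Q)" and "n > 0" "\<theta> > 0"
    and trunc: "2 ^ n * sqrt (sqrt \<theta> * pow32_bound ^ n) \<le> n / 4"
    and few: "(real (card (packet_index \<theta> Q n))) ^ 3 * (4 / \<theta>) \<le> real Q * n / 16"
  obtains m0 m where "inj_on (\<lambda>i. freq Q n m0 m (snd i)) (packet_index \<theta> Q n)"
    "n / 192 \<le> (LINT x|torus. maxsum \<theta> Q n m0 m x)"
proof -
  let ?Y = "PiE (nodes n) (\<lambda>_. {0..<int Q})" and ?Z = "{0..<int Q}" and ?I = "packet_index \<theta> Q n"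
  define D where "D = real (Q ^ card (nodes n))"
  have D: "D > 0" using Q(2) by (simp add: D_def)
  let ?B = "\<lambda>m0. collisions \<theta> Q n m0"
  have Bsub: "?B m0 \<subseteq> ?Y" and finB: "finite (?B m0)" for m0
    by (auto simp: collisions_def)
  define g where "g x = (\<Sum>m0\<in>?Z. \<Sum>m\<in>?Y - ?B m0. maxsum \<theta> Q n m0 m x)" for x
  have total: "D * (real Q * (n / 8)) \<le> (\<Sum>m0\<in>?Z. \<Sum>m\<in>?Y. maxsum \<theta> Q n m0 m (of_int a / of_nat Q + t))"
    if a: "odd a" and t: "0 \<le> t" "t * real Q \<le> 1 / 6" for a t
  proof -
    have "D * (n / 4) \<le> D * (n / 2 - 2 ^ n * sqrt (sqrt \<theta> * pow32_bound ^ n))"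
      using trunc D by (intro mult_left_mono) auto
    also have "\<dots> \<le> norm (\<Sum>y\<in>?Y.
        \<Sum>w | w \<in> nodes n \<and> inpos n w < inpos n (descent (\<lambda>u. half Q (y u)) n). tpacket \<theta> Q n w y)"
      unfolding D_def using assms(5) by (intro sum_tpacket_right_turns_ge Q) auto
    finally have "real Q / 2 * (D * (n / 4)) \<le> real Q / 2 * norm (\<Sum>y\<in>?Y.
        \<Sum>w | w \<in> nodes n \<and> inpos n w < inpos n (descent (\<lambda>u. half Q (y u)) n). tpacket \<theta> Q n w y)"
      by (intro mult_left_mono) auto
    also have "\<dots> \<le> (\<Sum>m0\<in>?Z. \<Sum>m\<in>?Y.
        norm (psum \<theta> Q n m0 m (inpos n (descent (\<lambda>u. half Q (a * m u)) n)) (of_int a / of_nat Q + t)))"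
      by (rule sum_norm_psum_ge[OF Q(2) Q(3)[OF a] t])
    also have "\<dots> \<le> (\<Sum>m0\<in>?Z. \<Sum>m\<in>?Y. maxsum \<theta> Q n m0 m (of_int a / of_nat Q + t))"
    proof (intro sum_mono norm_psum_le_maxsum)
      fix m :: "bool list \<Rightarrow> int"
      show "inpos n (descent (\<lambda>u. half Q (a * m u)) n) \<le> 2 ^ Suc n"
        using inpos_bounds[of "descent (\<lambda>u. half Q (a * m u)) n" n] by simp
    qed
    finally show ?thesis by (simp add: mult_ac)
  qed
  have bad: "(\<Sum>m0\<in>?Z. \<Sum>m\<in>?B m0. maxsum \<theta> Q n m0 m x) \<le> D * (real Q * (n / 16))" for x
  proof -
    have "(\<Sum>m\<in>?B m0. maxsum \<theta> Q n m0 m x) \<le> D * (n / 16)" for m0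
    proof -
      have "real Q * (\<Sum>m\<in>?B m0. maxsum \<theta> Q n m0 m x) \<le> real Q * (\<Sum>m\<in>?B m0. card ?I)"
        using maxsum_bounds(2) by (intro mult_left_mono) (auto intro: sum_mono simp del: sum_constant)
      also have "\<dots> = (real Q * card (?B m0)) * card ?I" by simp
      also have "\<dots> \<le> ((card ?I)\<^sup>2 * (D * (4 / \<theta>))) * card ?I"
        unfolding D_def by (intro mult_right_mono card_collisions_le[OF Q(1,2) assms(5)]) auto
      also have "\<dots> = D * ((card ?I) ^ 3 * (4 / \<theta>))"
        by (simp add: power3_eq_cube power2_eq_square)
      also have "\<dots> \<le> D * (real Q * n / 16)"
        using few D by (intro mult_left_mono) auto
      also have "\<dots> = real Q * (D * (n / 16))" by simp
      finally show ?thesis using Q(2) by simp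
    qed
    then have "(\<Sum>m0\<in>?Z. \<Sum>m\<in>?B m0. maxsum \<theta> Q n m0 m x) \<le> (\<Sum>m0\<in>?Z. D * (n / 16))"
      by (intro sum_mono)
    then show ?thesis by (simp add: mult_ac)
  qed
  have g_ge: "D * (real Q * (n / 16)) \<le> g (of_int a / of_nat Q + t)"
    if "odd a" "0 \<le> t" "t * real Q \<le> 1 / 6" for a t
  proof -
    have "g x = (\<Sum>m0\<in>?Z. \<Sum>m\<in>?Y. maxsum \<theta> Q n m0 m x) - (\<Sum>m0\<in>?Z. \<Sum>m\<in>?B m0. maxsum \<theta> Q n m0 m x)" for x
      unfolding g_def sum_subtractf[symmetric]
      using Bsub by (intro sum.cong refl sum_diff) auto
    then show ?thesis using total[OF that] bad[of "of_int a / of_nat Q + t"] by simp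
  qed
  have int: "integrable torus g"
    unfolding g_def by (intro Bochner_Integration.integrable_sum integrable_maxsum)
  have "D * (real Q * (n / 16)) / 12 \<le> (LINT x|torus. g x)"
    using D g_ge by (intro integral_torus_ge[OF Q(1,2) int]) (auto simp: g_def intro!: sum_nonneg maxsum_bounds)
  also have "(LINT x|torus. g x) = (\<Sum>m0\<in>?Z. \<Sum>m\<in>?Y - ?B m0. (LINT x|torus. maxsum \<theta> Q n m0 m x))"
    unfolding g_def
    by (simp only: Bochner_Integration.integral_sum Bochner_Integration.integrable_sum integrable_maxsum)
  also have "\<dots> = (\<Sum>(m0, m)\<in>Sigma ?Z (\<lambda>m0. ?Y - ?B m0). (LINT x|torus. maxsum \<theta> Q n m0 m x))"
    by (rule sum.Sigma) auto
  finally have sum_ge: "(D * real Q) * (n / 192)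
      \<le> (\<Sum>p\<in>Sigma ?Z (\<lambda>m0. ?Y - ?B m0). (LINT x|torus. maxsum \<theta> Q n (fst p) (snd p) x))"
    by (simp add: split_beta)
  have "card (Sigma ?Z (\<lambda>m0. ?Y - ?B m0)) \<le> card (?Z \<times> ?Y)"
    by (intro card_mono) auto
  then have "real (card (Sigma ?Z (\<lambda>m0. ?Y - ?B m0))) \<le> real (card (?Z \<times> ?Y))"
    by (simp only: of_nat_le_iff)
  also have "\<dots> = D * real Q"
    by (simp add: D_def card_cartesian_product card_PiE)
  finally have "\<exists>p\<in>Sigma ?Z (\<lambda>m0. ?Y - ?B m0). n / 192 \<le> (LINT x|torus. maxsum \<theta> Q n (fst p) (snd p) x)"
    using D Q(2) assms(4) sum_ge by (intro exists_ge_average[of _ "D * real Q"]) auto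
  then obtain m0 m where "m \<in> ?Y - ?B m0" "n / 192 \<le> (LINT x|torus. maxsum \<theta> Q n m0 m x)"
    by auto
  then show ?thesis by (intro that[of m0 m]) (auto simp: collisions_def)
qed

lemma weak_L2_norm_ge_sqrt:
  assumes Q: "even Q" "Q > 0" "\<And>a. odd a \<Longrightarrow> coprime a (int Q)" and "n > 0" "\<theta> > 0"
    and trunc: "2 ^ n * sqrt (sqrt \<theta> * pow32_bound ^ n) \<le> n / 4"
    and few: "(real (card (packet_index \<theta> Q n))) ^ 3 * (4 / \<theta>) \<le> real Q * n / 16"
    and "Q \<le> N"
  shows "\<exists>\<sigma>. \<sigma> permutes {1..N} \<and> weak_L2_norm (max_partial_sum \<sigma> N) \<ge> ennreal (sqrt n / 960)"
proof -
  let ?I = "packet_index \<theta> Q n"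
  obtain m0 m where inj: "inj_on (\<lambda>i. freq Q n m0 m (snd i)) ?I"
    and int: "n / 192 \<le> (LINT x|torus. maxsum \<theta> Q n m0 m x)"
    using exists_good_frequencies[OF assms(1-7)] by blast
  let ?r = "\<lambda>i. freq Q n m0 m (snd i)"
  \<comment> \<open>The squared norm of all packets together is at most \<open>n\<close>, so this
    scaling puts the polynomial into the unit ball. The integral becomes
    \<open>sqrt n / 192\<close>, and the factor 5 of the weak bound leaves
    \<open>sqrt n / 960\<close>.\<close>
  let ?b = "\<lambda>i. pcoeff Q n (fst i) (snd i) / of_real (sqrt n)"
  have sub: "?r ` ?I \<subseteq> {1..N}"
    using freq_bounds[OF Q(2)] assms(8) by fastforce
  have "(\<Sum>i\<in>?I. (norm (?b i))\<^sup>2) = (\<Sum>i\<in>?I. (norm (pcoeff Q n (fst i) (snd i)))\<^sup>2) / n"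
    by (simp add: norm_divide power_divide sum_divide_distrib)
  also have "(\<Sum>i\<in>?I. (norm (pcoeff Q n (fst i) (snd i)))\<^sup>2)
      = (\<Sum>w\<in>nodes n. \<Sum>k\<in>large_coeffs \<theta> Q n w. (norm (pcoeff Q n w k))\<^sup>2)"
    unfolding packet_index_def by (subst sum.Sigma) (auto simp: split_beta)
  also have "\<dots> \<le> (\<Sum>w\<in>nodes n. (1 / 2) ^ length w)"
  proof (rule sum_mono)
    fix w assume w: "w \<in> nodes n"
    have "(\<Sum>k\<in>large_coeffs \<theta> Q n w. (norm (pcoeff Q n w k))\<^sup>2)
        \<le> (\<Sum>k\<in>PiE (nodes n) (\<lambda>_. dual Q). (norm (pcoeff Q n w k))\<^sup>2)"
      by (intro sum_mono2) (auto simp: large_coeffs_def)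
    then show "(\<Sum>k\<in>large_coeffs \<theta> Q n w. (norm (pcoeff Q n w k))\<^sup>2) \<le> (1 / 2) ^ length w"
      by (simp only: sum_pcoeff_squared[OF Q(1,2) w])
  qed
  also have "\<dots> = n" by (rule sum_nodes_half_power)
  finally have b: "(\<Sum>i\<in>?I. (norm (?b i))\<^sup>2) \<le> 1"
    using assms(4) by (simp add: divide_right_mono)
  have scaled: "tpoly J ?b ?r x = tpoly J (\<lambda>i. pcoeff Q n (fst i) (snd i)) ?r x / of_real (sqrt n)" for J x
    by (simp add: tpoly_def sum_divide_distrib)
  show ?thesis
  proof (rule weak_L2_norm_rearranged_ge[where key = "\<lambda>i. inpos n (fst i)"
        and g = "\<lambda>x. maxsum \<theta> Q n m0 m x / sqrt n" and r = ?r and b = ?b and I = ?I])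
    show "N \<ge> 1" using assms(8) Q(2) by simp
    show "integrable torus (\<lambda>x. maxsum \<theta> Q n m0 m x / sqrt n)"
      using integrable_maxsum by (intro integrable_divide) auto
    show "\<exists>T. maxsum \<theta> Q n m0 m x / sqrt n \<le> norm (tpoly {i \<in> ?I. inpos n (fst i) < T} ?b ?r x)" for x
    proof -
      obtain T where "maxsum \<theta> Q n m0 m x = norm (psum \<theta> Q n m0 m T x)"
        using maxsum_attained by blast
      then show ?thesis
        unfolding scaled psum_eq_tpoly by (intro exI[of _ T]) (simp add: norm_divide)
    qed
    have "n / sqrt n = sqrt n" using assms(4) by (simp add: real_div_sqrt)
    then have "5 * (sqrt n / 960) = n / 192 / sqrt n" by simp
    also have "\<dots> \<le> (LINT x|torus. maxsum \<theta> Q n m0 m x) / sqrt n"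
      using int by (intro divide_right_mono) auto
    finally show "5 * (sqrt n / 960) \<le> (LINT x|torus. maxsum \<theta> Q n m0 m x / sqrt n)" by simp
  qed (use inj sub b assms(4) in auto)
qed

subsection \<open>The parameters\<close>

lemma weak_L2_norm_ge_sqrt_log:
  assumes "n > 0" and L: "2 ^ 75 * pow32_bound ^ 14 \<le> 2 ^ L" and N: "2 ^ (L * n) \<le> N"
  shows "\<exists>\<sigma>. \<sigma> permutes {1..N} \<and> weak_L2_norm (max_partial_sum \<sigma> N) \<ge> ennreal (sqrt n / 960)"
proof -
  define Q where "Q = (2 :: nat) ^ (L * n)"
  define e where "e = (2 :: real) ^ n"
  define b where "b = pow32_bound ^ n"
  \<comment> \<open>With \<open>\<theta> = 1 / d\<^sup>2\<close> one has
    \<open>sqrt \<theta> * b = 1 / e ^ 6\<close>. The truncation error is the root of this times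
    \<open>e\<close>, that is \<open>1 / e\<^sup>2\<close>, and hence at most
    \<open>1 / 4\<close>.\<close>
  define d where "d = e ^ 6 * b"
  define \<theta> where "\<theta> = 1 / d\<^sup>2"
  have e: "e \<ge> 2" using assms(1) power_increasing[of 1 n "2 :: real"] by (simp add: e_def)
  have b: "b \<ge> 1" using pow32_bound_ge_1 by (simp add: b_def)
  have d: "d > 0" using e b by (simp add: d_def)
  have \<theta>: "\<theta> > 0" using d by (simp add: \<theta>_def)
  have sq: "sqrt \<theta> = 1 / d" using d by (simp add: \<theta>_def real_sqrt_divide)
  have "1 \<le> pow32_bound ^ 14" using pow32_bound_ge_1 by simp
  then have "L \<noteq> 0" using L by (intro notI) simp
  then have Q: "even Q" "Q > 0" "\<And>a. odd a \<Longrightarrow> coprime a (int Q)"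
    using assms(1) by (auto simp: Q_def)
  have "sqrt \<theta> * pow32_bound ^ n = (1 / e ^ 3)\<^sup>2"
    using e b by (simp add: sq d_def b_def[symmetric] power_divide flip: power_mult)
  then have "2 ^ n * sqrt (sqrt \<theta> * pow32_bound ^ n) = e * (1 / e ^ 3)"
    using e by (simp add: e_def[symmetric])
  also have "\<dots> = 1 / e\<^sup>2" using e by (simp add: power3_eq_cube power2_eq_square)
  also have "\<dots> \<le> 1 / 2\<^sup>2" using e by (intro divide_left_mono power_mono) auto
  also have "\<dots> \<le> n / 4" using assms(1) by simp
  finally have trunc: "2 ^ n * sqrt (sqrt \<theta> * pow32_bound ^ n) \<le> n / 4" .
  let ?c = "real (card (packet_index \<theta> Q n))"
  have pow: "pow32 \<theta> = 1 / d ^ 3"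
    unfolding pow32_def sq by (simp add: \<theta>_def power2_eq_square power3_eq_cube)
  have "?c * pow32 \<theta> = (\<Sum>w\<in>nodes n. card (large_coeffs \<theta> Q n w) * pow32 \<theta>)"
    by (simp add: packet_index_def sum_distrib_right)
  also have "\<dots> \<le> (\<Sum>w\<in>nodes n. b)"
    unfolding b_def by (intro sum_mono card_large_coeffs_le Q \<theta>)
  also have "\<dots> \<le> e * b"
  proof -
    have "real (card (nodes n)) \<le> real (2 ^ n)" using card_nodes_le[of n] by (simp only: of_nat_le_iff)
    then show ?thesis using b by (simp add: e_def mult_right_mono)
  qed
  finally have "?c \<le> e * b * d ^ 3"
    using d by (simp add: pow field_simps)
  then have "?c ^ 3 \<le> (e * b * d ^ 3) ^ 3" by (rule power_mono) simp
  \<comment> \<open>The product is \<open>4 * e ^ 3 * b ^ 3 * d ^ 11 = 4 * e ^ 69 * b ^ 14\<close>.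
    The missing factor \<open>1 / 16\<close> is paid for by \<open>64 \<le> e ^ 6\<close>, which
    explains the exponents 75 and 14 in the condition on \<open>L\<close>.\<close>
  then have "?c ^ 3 * (4 / \<theta>) \<le> (e * b * d ^ 3) ^ 3 * (4 / \<theta>)"
    using \<theta> by (intro mult_right_mono) auto
  also have "\<dots> = 4 * (e * b * d ^ 3) ^ 3 * d\<^sup>2"
    by (simp add: \<theta>_def)
  also have "\<dots> = 4 * (b ^ 3 * (e ^ 3 * (b ^ 11 * e ^ 66)))"
    by (simp add: d_def power_mult_distrib mult_ac flip: power_mult power_add)
  also have "\<dots> = 4 * ((e ^ 3 * e ^ 66) * (b ^ 3 * b ^ 11))"
    by (simp only: mult_ac)
  also have "e ^ 3 * e ^ 66 = e ^ 69" by (simp flip: power_add)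
  also have "b ^ 3 * b ^ 11 = b ^ 14" by (simp flip: power_add)
  also have "4 * (e ^ 69 * b ^ 14) \<le> (e ^ 6 * (e ^ 69 * b ^ 14)) / 16"
  proof -
    have "(2 :: real) ^ 6 \<le> e ^ 6" using e by (intro power_mono) auto
    then have "64 * (e ^ 69 * b ^ 14) \<le> e ^ 6 * (e ^ 69 * b ^ 14)"
      using e b by (intro mult_right_mono) auto
    then show ?thesis by linarith
  qed
  also have "e ^ 6 * (e ^ 69 * b ^ 14) = e ^ 75 * b ^ 14"
  proof -
    have "e ^ 6 * e ^ 69 = e ^ 75" by (simp flip: power_add)
    then show ?thesis by (simp only: mult.assoc[symmetric])
  qed
  also have "\<dots> = (2 ^ 75 * pow32_bound ^ 14) ^ n"
  proof -
    have "e ^ 75 = (2 ^ 75) ^ n" "b ^ 14 = (pow32_bound ^ 14) ^ n"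
      by (simp_all only: e_def b_def power_mult[symmetric] mult.commute)
    then show ?thesis by (simp only: power_mult_distrib)
  qed
  also have "\<dots> / 16 \<le> (2 ^ L) ^ n / 16"
    using pow32_bound_ge_1 by (intro divide_right_mono power_mono L) auto
  also have "\<dots> = real Q / 16" by (simp add: Q_def power_mult)
  also have "\<dots> \<le> real Q * n / 16"
    using assms(1) mult_left_mono[of 1 "real n" "real Q"] by simp
  finally have few: "?c ^ 3 * (4 / \<theta>) \<le> real Q * n / 16" .
  show ?thesis
    using weak_L2_norm_ge_sqrt[OF Q assms(1) \<theta> trunc few] N by (simp add: Q_def)
qed

text \<open>A single exponential has a maximal function of constant modulus 1. This serves the small
  \<open>N\<close> that leave no room for a tree of positive depth.\<close>

lemma weak_L2_norm_ge_const:
  assumes "N \<ge> 1"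
  shows "\<exists>\<sigma>. \<sigma> permutes {1..N} \<and> weak_L2_norm (max_partial_sum \<sigma> N) \<ge> ennreal (1 / 5)"
proof (rule weak_L2_norm_rearranged_ge[where I = "{()}" and b = "\<lambda>_. 1" and r = "\<lambda>_. 1"
      and key = "\<lambda>_. 0" and g = "\<lambda>_. 1"])
  show "\<exists>T. 1 \<le> norm (tpoly {i \<in> {()}. (0 :: nat) < T} (\<lambda>_. 1) (\<lambda>_. 1) x)" for x
    by (intro exI[of _ 1]) (simp add: tpoly_def)
  show "integrable torus (\<lambda>_. 1 :: real)"
    by (rule integrable_torus_bounded[where B = 1]) auto
  show "5 * (1 / 5) \<le> (LINT x|torus. 1 :: real)" by (simp add: measure_space_torus)
qed (use assms in auto)

theorem corollary1p1:
  shows "\<exists>c::real. c > 0 \<and>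
    (\<forall>N::nat. N > 1 \<longrightarrow>
      (\<exists>\<sigma>. \<sigma> permutes {1..N} \<and>
        weak_L2_norm (max_partial_sum \<sigma> N) \<ge> ennreal (c * sqrt (ln (real N)))))"
proof -
  obtain L where L: "2 ^ 75 * pow32_bound ^ 14 < (2 :: real) ^ L"
    using real_arch_pow[of 2 "2 ^ 75 * pow32_bound ^ 14"] by auto
  have "1 \<le> pow32_bound ^ 14" using pow32_bound_ge_1 by simp
  then have "L \<noteq> 0" using L by (intro notI) simp
  let ?c = "1 / (960 * sqrt (2 * L))"
  have "\<exists>\<sigma>. \<sigma> permutes {1..N} \<and> weak_L2_norm (max_partial_sum \<sigma> N) \<ge> ennreal (?c * sqrt (ln (real N)))"
    if N: "N > 1" for N :: nat
  proof -
    \<comment> \<open>The largest depth with \<open>2 ^ (L * n) \<le> N\<close>. Then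
      \<open>ln N < L * (n + 1)\<close>, which is at most \<open>2 * L * n\<close> if
      \<open>n > 0\<close> and at most \<open>2 * L\<close> if \<open>n = 0\<close>; hence the
      \<open>sqrt (2 * L)\<close> in \<open>?c\<close>.\<close>
    define n where "n = nat \<lfloor>log 2 N / L\<rfloor>"
    have log0: "log 2 N \<ge> 0" using N by simp
    have "log 2 N / L < real n + 1"
      unfolding n_def by linarith
    then have "log 2 N < L * (real n + 1)"
      using \<open>L \<noteq> 0\<close> by (simp add: field_simps)
    moreover have "ln (real N) \<le> log 2 N"
    proof -
      have "ln (real N) = log 2 N * ln 2" by (simp add: log_def)
      also have "\<dots> \<le> log 2 N * 1" using log0 ln2_le_25_over_36 by (intro mult_left_mono) auto
      finally show ?thesis by simp
    qed
    ultimately have lnN: "ln (real N) < L * (real n + 1)" by linarith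
    show ?thesis
    proof (cases "n = 0")
      case True
      then have "sqrt (ln (real N)) \<le> sqrt (2 * L)"
        using lnN by (intro real_sqrt_le_mono) auto
      then have "?c * sqrt (ln (real N)) \<le> ?c * sqrt (2 * L)"
        by (intro mult_left_mono) auto
      also have "\<dots> \<le> 1 / 5" using \<open>L \<noteq> 0\<close> by simp
      finally have le: "ennreal (?c * sqrt (ln (real N))) \<le> ennreal (1 / 5)"
        by (rule ennreal_leI)
      obtain \<sigma> where "\<sigma> permutes {1..N}" "ennreal (1 / 5) \<le> weak_L2_norm (max_partial_sum \<sigma> N)"
        using weak_L2_norm_ge_const[of N] N by auto
      then show ?thesis using order_trans[OF le] by blast
    next
      case False
      have "L * (real n + 1) \<le> L * (2 * real n)" using False by (intro mult_left_mono) auto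
      then have "sqrt (ln (real N)) \<le> sqrt (2 * L * n)"
        using lnN by (intro real_sqrt_le_mono) auto
      then have "?c * sqrt (ln (real N)) \<le> ?c * sqrt (2 * L * n)"
        by (intro mult_left_mono) auto
      also have "\<dots> = sqrt n / 960" using \<open>L \<noteq> 0\<close> by (simp add: real_sqrt_mult)
      finally have le: "ennreal (?c * sqrt (ln (real N))) \<le> ennreal (sqrt n / 960)"
        by (rule ennreal_leI)
      have "real n \<le> log 2 N / L" unfolding n_def using log0 by simp
      then have "real (L * n) \<le> log 2 N" using \<open>L \<noteq> 0\<close> by (simp add: field_simps)
      then have "2 powr real (L * n) \<le> real N" using N by (subst le_log_iff[symmetric]) auto
      then have "real (2 ^ (L * n)) \<le> real N" by (subst (asm) powr_realpow) auto
      then have "2 ^ (L * n) \<le> N" by (simp only: of_nat_le_iff)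
      then obtain \<sigma> where "\<sigma> permutes {1..N}" "ennreal (sqrt n / 960) \<le> weak_L2_norm (max_partial_sum \<sigma> N)"
        using weak_L2_norm_ge_sqrt_log[OF _ less_imp_le[OF L]] False by blast
      then show ?thesis using order_trans[OF le] by blast
    qed
  qed
  moreover have "?c > 0" using \<open>L \<noteq> 0\<close> by simp
  ultimately show ?thesis by blast
qed

end
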